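(* Let $d\geq 1$ and let $T$ be a minimally $d$-rigid graph with $T\neq K_2$ and $T\ne K_3$. Then $a_d(T)\leq 1$, and equality holds if $T=S_{n,d}$ (for some $n\ge d+1$).
   Context: For a graph $G=(V,E)$ and $p:V\to\mathbb R^d$, let $d_{uv}=\frac{p(u)-p(v)}{\|p(u)-p(v)\|}$ if $p(u)\ne p(v)$ and $0$ otherwise; let $R(G,p)\in\mathbb R^{d|V|\times |E|}$ have columns $(1_u-1_v)\otimes d_{uv}$ for $\{u,v\}\in E$ ($1_u$ standard basis vectors, $\otimes$ Kronecker product), and $L(G,p)=R(G,p)R(G,p)^T$. With $\lambda_i$ the $i$-th smallest eigenvalue, $a_d(G)=\sup_{p:V\to\mathbb R^d}\lambda_{\binom{d+1}{2}+1}(L(G,p))$. A graph $G$ is $d$-rigid if $\operatorname{rank}R(G,p)=d|V|-\binom{d+1}{2}$ for some $p$ (equivalently $a_d(G)>0$), and minimally $d$-rigid if it is $d$-rigid but $G\setminus e$ is not $d$-rigid for every edge $e$. For $n\ge d+1$, $S_{n,d}$ is the graph on vertex set $[n]$ with edge set $\{\{i,j\}: i\in[d],\ j\in[n]\setminus\{i\}\}$ (a $d$-clique joined completely to $n-d$ further independent vertices).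
   Formalization: The formal version also assumes d ≤ |V| (otherwise K_{1,3} with d=6 meets the rank definition of minimally d-rigid but has a_6 ≥ 2) and binom(d+1,2)+1 ≤ d|V|, so that the eigenvalue defining a_d(T) exists. *)

theory Defs
  imports
    Complex_Main
    "Jordan_Normal_Form.Char_Poly"
    "Jordan_Normal_Form.DL_Rank"
begin

type_synonym 'a graph = "'a set \<times> 'a set set"

abbreviation verts :: "'a graph \<Rightarrow> 'a set" where "verts G \<equiv> fst G"
abbreviation edges :: "'a graph \<Rightarrow> 'a set set" where "edges G \<equiv> snd G"

definition simple_graph :: "'a graph \<Rightarrow> bool" where
  "simple_graph G \<longleftrightarrow> finite (verts G) \<and> (\<forall>e\<in>edges G. e \<subseteq> verts G \<and> card e = 2)"

definition graph_iso :: "'a graph \<Rightarrow> 'b graph \<Rightarrow> bool" where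
  "graph_iso G H \<longleftrightarrow> (\<exists>f. bij_betw f (verts G) (verts H) \<and> edges H = (\<lambda>e. f ` e) ` edges G)"

definition del_edge :: "'a graph \<Rightarrow> 'a set \<Rightarrow> 'a graph" where
  "del_edge G e = (verts G, edges G - {e})"

definition complete_graph :: "nat \<Rightarrow> nat graph" where
  "complete_graph n = ({1..n}, {{i, j} | i j. i \<in> {1..n} \<and> j \<in> {1..n} - {i}})"

definition S_graph :: "nat \<Rightarrow> nat \<Rightarrow> nat graph" where
  "S_graph n d = ({1..n}, {{i, j} | i j. i \<in> {1..d} \<and> j \<in> {1..n} - {i}})"

text \<open>
  Rows and columns of the rigidity matrix are numbered by an arbitrary but fixed enumeration of the
  vertices and of the edges; the latter also picks an order of the endpoints of each edge.  The
  column of an edge does not depend on that order, since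
  \<open>(1\<^sub>u - 1\<^sub>v) \<otimes> d\<^sub>u\<^sub>v = (1\<^sub>v - 1\<^sub>u) \<otimes> d\<^sub>v\<^sub>u\<close>, and rank and spectrum do not
  depend on the enumerations.
\<close>

definition vert_list :: "'a graph \<Rightarrow> 'a list" where
  "vert_list G = (SOME vs. distinct vs \<and> set vs = verts G)"

definition edge_list :: "'a graph \<Rightarrow> ('a \<times> 'a) list" where
  "edge_list G = (SOME es. distinct (map (\<lambda>(u, v). {u, v}) es) \<and>
                           set (map (\<lambda>(u, v). {u, v}) es) = edges G)"

definition vec_len :: "real vec \<Rightarrow> real" where
  "vec_len x = sqrt (x \<bullet> x)"

definition edge_dir :: "('a \<Rightarrow> real vec) \<Rightarrow> 'a \<Rightarrow> 'a \<Rightarrow> real vec" where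
  "edge_dir p u v =
     (if p u \<noteq> p v then (1 / vec_len (p u - p v)) \<cdot>\<^sub>v (p u - p v) else 0\<^sub>v (dim_vec (p u)))"

definition vert_unit :: "'a graph \<Rightarrow> 'a \<Rightarrow> real vec" where
  "vert_unit G u = vec (card (verts G)) (\<lambda>i. if vert_list G ! i = u then 1 else 0)"

definition kron_vec :: "real vec \<Rightarrow> real vec \<Rightarrow> real vec" where
  "kron_vec x y = vec (dim_vec x * dim_vec y) (\<lambda>k. x $ (k div dim_vec y) * y $ (k mod dim_vec y))"

definition placements :: "nat \<Rightarrow> 'a graph \<Rightarrow> ('a \<Rightarrow> real vec) set" where
  "placements d G = {p. \<forall>v\<in>verts G. p v \<in> carrier_vec d}"

definition rigidity_mat :: "nat \<Rightarrow> 'a graph \<Rightarrow> ('a \<Rightarrow> real vec) \<Rightarrow> real mat" where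
  "rigidity_mat d G p = mat_of_cols (d * card (verts G))
     (map (\<lambda>(u, v). kron_vec (vert_unit G u - vert_unit G v) (edge_dir p u v)) (edge_list G))"

definition stiffness_mat :: "nat \<Rightarrow> 'a graph \<Rightarrow> ('a \<Rightarrow> real vec) \<Rightarrow> real mat" where
  "stiffness_mat d G p = rigidity_mat d G p * transpose_mat (rigidity_mat d G p)"

text \<open>
  The \<open>i\<close>-th smallest real eigenvalue, counted with multiplicity and starting from \<open>i = 1\<close>;
  meaningful for symmetric \<open>A\<close> and \<open>1 \<le> i \<le> dim_row A\<close>.
\<close>

definition nth_eigenvalue :: "nat \<Rightarrow> real mat \<Rightarrow> real" where
  "nth_eigenvalue i A = sorted_list_of_multiset (proots (char_poly A)) ! (i - 1)"

definition alg_connectivity :: "nat \<Rightarrow> 'a graph \<Rightarrow> real" where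
  "alg_connectivity d G =
     (SUP p\<in>placements d G. nth_eigenvalue (((d + 1) choose 2) + 1) (stiffness_mat d G p))"

definition rigid :: "nat \<Rightarrow> 'a graph \<Rightarrow> bool" where
  "rigid d G \<longleftrightarrow> (\<exists>p\<in>placements d G.
     int (vec_space.rank (d * card (verts G)) (rigidity_mat d G p))
       = int (d * card (verts G)) - int ((d + 1) choose 2))"

definition minimally_rigid :: "nat \<Rightarrow> 'a graph \<Rightarrow> bool" where
  "minimally_rigid d G \<longleftrightarrow> rigid d G \<and> (\<forall>e\<in>edges G. \<not> rigid d (del_edge G e))"

end

theory Submission
  imports Defs "HOL-Analysis.Function_Topology"
begin

text \<open>
  Minimality forces \<open>|E| = d |V| - (d + 1 choose 2)\<close>, so the eigenvalue in the definition of \<open>a\<^sub>d\<close> is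
  the least eigenvalue of \<open>R\<^sup>T R\<close>, and bounding it by 1 amounts to finding edge weights
  \<open>\<omega> \<noteq> 0\<close> with \<open>|R \<omega>|\<^sup>2 \<le> |\<omega>|\<^sup>2\<close>.
  At a vertex of degree greater than \<open>d\<close> the edge directions are linearly dependent, and a dependency
  is such an \<open>\<omega>\<close>: the star centre contributes nothing and each leaf at most its own weight squared.
  If all degrees are at most \<open>d\<close>, then counting edges leaves only complete graphs on at least four
  vertices; on a \<open>K\<^sub>4\<close> in them one weights a 4-cycle by alternately signed edge lengths.
  For \<open>S\<^sub>n\<^sub>,\<^sub>d\<close> the value 1 is attained by placing the clique at the standard basis vectors and
  all other vertices at the origin.
\<close>

section \<open>Eigenvalues of Gram matrices\<close>

lemma det_smult_one: "det (c \<cdot>\<^sub>m 1\<^sub>m n) = (c :: 'a :: comm_ring_1) ^ n"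
  by (simp add: det_smult)

lemma smult_mat_mult_vec:
  assumes "A \<in> carrier_mat n m" "w \<in> carrier_vec m"
  shows "(k \<cdot>\<^sub>m A) *\<^sub>v w = k \<cdot>\<^sub>v (A *\<^sub>v (w :: 'a :: comm_ring_1 vec))"
  using assms by (intro eq_vecI) auto

text \<open>The determinant of one block matrix \<open>M\<close> is evaluated twice.
  \<open>M * P\<close> is block upper triangular with diagonal blocks \<open>X - A * B\<close> and
  1, and \<open>Q * M\<close> with diagonal blocks \<open>X\<close> and \<open>X - B * A\<close>,
  while \<open>det P = 1\<close> and \<open>det Q = X ^ m\<close>. \<open>C\<close> and
  \<open>D\<close> are \<open>A\<close> and \<open>B\<close> with their entries read as constant
  polynomials.\<close>

lemma char_poly_mult_swap:
  fixes A B :: "'a :: field mat"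
  assumes A: "A \<in> carrier_mat N m" and B: "B \<in> carrier_mat m N"
  shows "[:0, 1:] ^ m * char_poly (A * B) = [:0, 1:] ^ N * char_poly (B * A)"
proof -
  define X :: "'a poly" where "X = [:0, 1:]"
  define C where "C = map_mat (\<lambda>a. [:a:]) A"
  define D where "D = map_mat (\<lambda>a. [:a:]) B"
  have C: "C \<in> carrier_mat N m" and D: "D \<in> carrier_mat m N"
    using A B by (auto simp: C_def D_def)
  have AB: "char_poly_matrix (A * B) = X \<cdot>\<^sub>m 1\<^sub>m N - C * D"
    using A B by (intro eq_matI) (auto simp: char_poly_matrix_def X_def C_def D_def scalar_prod_def sum_to_poly mult.commute)
  have BA: "char_poly_matrix (B * A) = X \<cdot>\<^sub>m 1\<^sub>m m - D * C"
    using A B by (intro eq_matI) (auto simp: char_poly_matrix_def X_def C_def D_def scalar_prod_def sum_to_poly mult.commute)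
  define M where "M = four_block_mat (X \<cdot>\<^sub>m 1\<^sub>m N) C D (1\<^sub>m m)"
  define P where "P = four_block_mat (1\<^sub>m N) (0\<^sub>m N m) (- D) (1\<^sub>m m)"
  define Q where "Q = four_block_mat (1\<^sub>m N) (0\<^sub>m N m) (- D) (X \<cdot>\<^sub>m 1\<^sub>m m)"
  have M: "M \<in> carrier_mat (N + m) (N + m)" and P: "P \<in> carrier_mat (N + m) (N + m)"
    and Q: "Q \<in> carrier_mat (N + m) (N + m)"
    using C D by (auto simp: M_def P_def Q_def)
  have sq: "X \<cdot>\<^sub>m 1\<^sub>m N - C * D \<in> carrier_mat N N" "X \<cdot>\<^sub>m 1\<^sub>m m - D * C \<in> carrier_mat m m"
    using C D by (auto intro!: minus_carrier_mat)
  have "M * P = four_block_mat (X \<cdot>\<^sub>m 1\<^sub>m N - C * D) C (0\<^sub>m m N) (1\<^sub>m m)"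
    unfolding M_def P_def using C D
    by (subst mult_four_block_mat[of _ N N _ m _ m _ _ N _ m])
      (simp_all add: add_uminus_minus_mat[of _ N N] mult_smult_assoc_mat[of _ N N]
        add_uminus_minus_mat[of _ m N])
  then have "det M * det P = char_poly (A * B)"
    unfolding char_poly_def AB det_mult[OF M P, symmetric]
    using det_four_block_mat_lower_left_zero[OF sq(1) C refl one_carrier_mat] by simp
  moreover have "det P = 1"
    unfolding P_def using C D by (subst det_four_block_mat_upper_right_zero[of _ N _ m]) auto
  moreover have DC: "- (D * C) + X \<cdot>\<^sub>m 1\<^sub>m m = X \<cdot>\<^sub>m 1\<^sub>m m - D * C"
    using C D comm_add_mat[of "- (D * C)" m m "X \<cdot>\<^sub>m 1\<^sub>m m"]
    by (simp add: add_uminus_minus_mat[of _ m m])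
  have XD: "X \<cdot>\<^sub>m - D + X \<cdot>\<^sub>m D = 0\<^sub>m m N" using D by (intro eq_matI) auto
  have "Q * M = four_block_mat (X \<cdot>\<^sub>m 1\<^sub>m N) C (0\<^sub>m m N) (X \<cdot>\<^sub>m 1\<^sub>m m - D * C)"
    unfolding M_def Q_def using C D
    by (subst mult_four_block_mat[of _ N N _ m _ m _ _ N _ m])
      (simp_all add: DC XD mult_smult_distrib[of _ m N _ N] mult_smult_assoc_mat[of _ m m])
  then have "det Q * det M = X ^ N * char_poly (B * A)"
    unfolding char_poly_def BA det_mult[OF Q M, symmetric]
    using det_four_block_mat_lower_left_zero[OF _ C refl sq(2), of "X \<cdot>\<^sub>m 1\<^sub>m N"]
    by (simp add: det_smult_one)
  moreover have "det Q = X ^ m"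
    unfolding Q_def using C D by (subst det_four_block_mat_upper_right_zero[of _ N _ m]) (auto simp: det_smult_one)
  ultimately show ?thesis by (simp add: X_def)
qed

lemma char_poly_nonzero: "A \<in> carrier_mat n n \<Longrightarrow> char_poly (A :: 'a :: idom mat) \<noteq> 0"
  using degree_monic_char_poly[of A n] by auto

lemma proots_char_poly_mult_swap:
  fixes A B :: "'a :: field mat"
  assumes A: "A \<in> carrier_mat N m" and B: "B \<in> carrier_mat m N" and le: "m \<le> N"
  shows "proots (char_poly (A * B)) = replicate_mset (N - m) 0 + proots (char_poly (B * A))"
proof -
  have nz: "char_poly (A * B) \<noteq> 0" "char_poly (B * A) \<noteq> 0"
    using A B by (auto intro!: char_poly_nonzero)
  have X: "proots ([:0, 1:] ^ k) = replicate_mset k (0 :: 'a)" for k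
    by (simp add: proots_power)
  have "proots ([:0, 1:] ^ m * char_poly (A * B)) = proots ([:0, 1:] ^ N * char_poly (B * A))"
    using char_poly_mult_swap[OF A B] by simp
  then have "replicate_mset m 0 + proots (char_poly (A * B)) = replicate_mset N 0 + proots (char_poly (B * A))"
    using nz by (simp add: proots_mult X del: proots_linear_factor)
  moreover have "replicate_mset N (0 :: 'a) = replicate_mset m 0 + replicate_mset (N - m) 0"
    using le by (intro multiset_eqI) auto
  ultimately show ?thesis by simp
qed

lemma sorted_list_of_multiset_replicate_plus:
  assumes "\<And>x. x \<in># S \<Longrightarrow> a \<le> x"
  shows "sorted_list_of_multiset (replicate_mset k a + S) = replicate k a @ sorted_list_of_multiset S"
proof -
  have "sort (replicate k a @ sorted_list_of_multiset S) = replicate k a @ sorted_list_of_multiset S"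
    using assms by (intro sorted_sort_id) (auto simp: sorted_append)
  then show ?thesis
    by (metis mset_append mset_replicate mset_sorted_list_of_multiset sorted_list_of_multiset_mset)
qed

section \<open>Gram forms and the least eigenvalue of a symmetric matrix\<close>

lemma scalar_prod_self: "w \<bullet> w = (\<Sum>i<dim_vec w. ((w :: real vec) $ i)\<^sup>2)"
  by (simp add: scalar_prod_def power2_eq_square lessThan_atLeast0)

lemma scalar_prod_self_nonneg: "(w :: real vec) \<bullet> w \<ge> 0"
  by (simp add: scalar_prod_self sum_nonneg)

lemma scalar_prod_self_pos:
  fixes w :: "real vec"
  assumes "w \<in> carrier_vec m" "w \<noteq> 0\<^sub>v m"
  shows "w \<bullet> w > 0"
proof -
  obtain i where "i < m" "w $ i \<noteq> 0" using assms by (metis carrier_vecD eq_vecI index_zero_vec)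
  then show ?thesis using assms by (auto simp: scalar_prod_self intro!: sum_pos2)
qed

lemma gram_form:
  fixes R :: "real mat"
  assumes R: "R \<in> carrier_mat N m" and w: "w \<in> carrier_vec m"
  shows "w \<bullet> ((transpose_mat R * R) *\<^sub>v w) = (R *\<^sub>v w) \<bullet> (R *\<^sub>v w)"
proof -
  have Rw: "R *\<^sub>v w \<in> carrier_vec N" using R w by auto
  have "w \<bullet> ((transpose_mat R * R) *\<^sub>v w) = w \<bullet> (transpose_mat R *\<^sub>v (R *\<^sub>v w))"
    using R w by (metis assoc_mult_mat_vec transpose_carrier_mat)
  also have "\<dots> = (transpose_mat R *\<^sub>v (R *\<^sub>v w)) \<bullet> w"
    using R w by (intro comm_scalar_prod[of _ m]) auto
  also have "\<dots> = (R *\<^sub>v w) \<bullet> (R *\<^sub>v w)" by (rule transpose_vec_mult_scalar[OF R w Rw])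
  finally show ?thesis .
qed

lemma eigenvalue_gram_vector:
  fixes R :: "real mat"
  assumes R: "R \<in> carrier_mat N m" and ev: "eigenvalue (transpose_mat R * R) k"
  shows "\<exists>w \<in> carrier_vec m. w \<noteq> 0\<^sub>v m \<and> (R *\<^sub>v w) \<bullet> (R *\<^sub>v w) = k * (w \<bullet> w)"
proof -
  obtain w where w: "w \<in> carrier_vec m" "w \<noteq> 0\<^sub>v m" "(transpose_mat R * R) *\<^sub>v w = k \<cdot>\<^sub>v w"
    using ev R by (auto simp: eigenvalue_def eigenvector_def)
  then show ?thesis using gram_form[OF R w(1)] by auto
qed

lemma eigenvalue_gram_nonneg:
  fixes R :: "real mat"
  assumes R: "R \<in> carrier_mat N m" and ev: "eigenvalue (transpose_mat R * R) k"
  shows "k \<ge> 0"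
proof -
  obtain w where w: "w \<in> carrier_vec m" "w \<noteq> 0\<^sub>v m" "(R *\<^sub>v w) \<bullet> (R *\<^sub>v w) = k * (w \<bullet> w)"
    using eigenvalue_gram_vector[OF R ev] by auto
  have "0 \<le> k * (w \<bullet> w)" using w(3) by (metis scalar_prod_self_nonneg)
  then show ?thesis using scalar_prod_self_pos[OF w(1,2)] by (simp add: zero_le_mult_iff)
qed

text \<open>First variation at a minimum: moving from \<open>x\<close> in the direction
  \<open>h = M x\<close> changes the form by \<open>2 t |h|^2 + t^2 c\<close>, and for small
  negative \<open>t\<close> the linear term would make it negative unless
  \<open>h = 0\<close>.\<close>

lemma psd_form_zero_imp_kernel:
  fixes M :: "real mat"
  assumes M: "M \<in> carrier_mat m m" "transpose_mat M = M"
    and psd: "\<And>w. w \<in> carrier_vec m \<Longrightarrow> 0 \<le> w \<bullet> (M *\<^sub>v w)"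
    and x: "x \<in> carrier_vec m" "x \<bullet> (M *\<^sub>v x) = 0"
  shows "M *\<^sub>v x = 0\<^sub>v m"
proof -
  define h where "h = M *\<^sub>v x"
  define a where "a = h \<bullet> h"
  define c where "c = h \<bullet> (M *\<^sub>v h)"
  have h: "h \<in> carrier_vec m" using M x by (auto simp: h_def)
  have c0: "c \<ge> 0" using psd[OF h] by (simp add: c_def)
  have xMh: "x \<bullet> (M *\<^sub>v h) = a"
    using transpose_vec_mult_scalar[of M m m h x] M x h
    by (simp add: h_def a_def comm_scalar_prod[of _ m])
  have "0 \<le> 2 * t * a + t\<^sup>2 * c" for t
  proof -
    have "(x + t \<cdot>\<^sub>v h) \<bullet> (M *\<^sub>v (x + t \<cdot>\<^sub>v h)) = 2 * t * a + t\<^sup>2 * c"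
      using M x h xMh
      by (simp add: mult_add_distrib_mat_vec[of _ m m] mult_mat_vec[of _ m m] add_scalar_prod_distrib[of _ m]
           scalar_prod_add_distrib[of _ m] a_def c_def power2_eq_square algebra_simps flip: h_def)
    then show ?thesis using psd[of "x + t \<cdot>\<^sub>v h"] x h by simp
  qed
  \<comment> \<open>The minimizer would be \<open>- a / c\<close>; the denominator
    \<open>c + 1\<close> stays positive when \<open>c = 0\<close> and still makes the value negative
    unless \<open>a = 0\<close>.\<close>
  from this[of "- a / (c + 1)"] have "0 \<le> - (2 * a\<^sup>2 / (c + 1)) + a\<^sup>2 * c / (c + 1)\<^sup>2"
    by (simp add: power2_eq_square)
  also have "\<dots> = - (a\<^sup>2 * (c + 2) / (c + 1)\<^sup>2)"
    using c0 by (simp add: divide_simps) (simp add: algebra_simps power2_eq_square)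
  finally have "a\<^sup>2 * (c + 2) / (c + 1)\<^sup>2 \<le> 0" by simp
  then have "a = 0" using c0 by (simp add: divide_le_0_iff mult_le_0_iff)
  then show ?thesis using h scalar_prod_self_pos[OF h] by (auto simp: a_def h_def)
qed

lemma transpose_smult_one: "transpose_mat (k \<cdot>\<^sub>m 1\<^sub>m n) = k \<cdot>\<^sub>m (1\<^sub>m n :: 'a :: semiring_1 mat)"
  by (intro eq_matI) auto

text \<open>Rayleigh's principle: the quadratic form attains its minimum \<open>\<mu>\<close> on the
  unit sphere. Then \<open>A - \<mu> I\<close> is positive semidefinite with form 0 at the
  minimizer, which therefore lies in its kernel and is an eigenvector.\<close>

lemma symmetric_min_eigenvalue:
  fixes A :: "real mat"
  assumes A: "A \<in> carrier_mat m m" "transpose_mat A = A" and m: "m > 0"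
  shows "\<exists>\<mu>. eigenvalue A \<mu> \<and> (\<forall>w \<in> carrier_vec m. \<mu> * (w \<bullet> w) \<le> w \<bullet> (A *\<^sub>v w))"
proof -
  define q where "q f = (\<Sum>i<m. \<Sum>j<m. f i * A $$ (i, j) * f j)" for f :: "nat \<Rightarrow> real"
  \<comment> \<open>The unit sphere inside the product space \<open>nat \<Rightarrow> real\<close>:
    coordinates from \<open>m\<close> on are pinned to 0 and the others confined to [-1, 1], so the
    surrounding box is compact by Tychonoff.\<close>
  define K where "K = PiE UNIV (\<lambda>i. if i < m then {-1..1} else {0 :: real}) \<inter> {f. (\<Sum>i<m. (f i)\<^sup>2) = 1}"
  have "compact (PiE UNIV (\<lambda>i. if i < m then {-1..1} else {0 :: real}))"
    using compactin_PiE[of "\<lambda>_. euclideanreal" UNIV "\<lambda>i. if i < m then {-1..1} else {0 :: real}"]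
    by (auto simp: euclidean_product_topology)
  moreover have "closed {f :: nat \<Rightarrow> real. (\<Sum>i<m. (f i)\<^sup>2) = 1}"
    by (intro closed_Collect_eq continuous_intros) auto
  ultimately have "compact K" unfolding K_def by (rule compact_Int_closed)
  moreover have "(\<lambda>i. if i = 0 then 1 else 0) \<in> K"
    using m by (auto simp: K_def if_distrib[of "\<lambda>x. x\<^sup>2"] cong: if_cong)
  moreover have "continuous_on UNIV q" unfolding q_def by (intro continuous_intros) auto
  then have "continuous_on K q" by (rule continuous_on_subset) simp
  ultimately obtain f where f: "f \<in> K" "\<And>g. g \<in> K \<Longrightarrow> q f \<le> q g"
    using continuous_attains_inf[of K q] by blast
  define \<mu> where "\<mu> = q f"
  define v where "v = vec m f"
  have v: "v \<in> carrier_vec m" by (simp add: v_def)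
  have form: "w \<bullet> (A *\<^sub>v w) = q (\<lambda>i. w $ i)" if "w \<in> carrier_vec m" for w
    using A that by (auto simp: q_def scalar_prod_def sum_distrib_left lessThan_atLeast0 mult.assoc intro!: sum.cong)
  have le: "\<mu> * (w \<bullet> w) \<le> w \<bullet> (A *\<^sub>v w)" if w: "w \<in> carrier_vec m" for w
  proof (cases "w = 0\<^sub>v m")
    case True
    then show ?thesis using A by auto
  next
    case False
    define s where "s = sqrt (w \<bullet> w)"
    have s: "s > 0" "s\<^sup>2 = w \<bullet> w" using scalar_prod_self_pos[OF w False] by (auto simp: s_def)
    define g where "g i = (if i < m then w $ i / s else 0)" for i
    have ww: "w \<bullet> w = (\<Sum>i<m. (w $ i)\<^sup>2)"
      using w by (auto simp: scalar_prod_def power2_eq_square lessThan_atLeast0)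
    have g1: "(\<Sum>i<m. (g i)\<^sup>2) = 1"
      using s scalar_prod_self_pos[OF w False] by (simp add: g_def power_divide flip: sum_divide_distrib ww)
    have "(g i)\<^sup>2 \<le> 1" if "i < m" for i
      using member_le_sum[of i "{..<m}" "\<lambda>i. (g i)\<^sup>2"] that g1 by simp
    then have "g i \<in> {-1..1}" if "i < m" for i
      using that by (simp add: abs_square_le_1 abs_le_iff del: divide_le_eq_1 le_divide_eq)
    moreover have "g i = 0" if "\<not> i < m" for i using that by (simp add: g_def)
    ultimately have "g \<in> K" using g1 by (simp add: K_def PiE_iff)
    then have "\<mu> \<le> q g" using f by (simp add: \<mu>_def)
    also have "q g = q (\<lambda>i. w $ i) / s\<^sup>2"
      by (auto simp: q_def g_def sum_divide_distrib power2_eq_square intro!: sum.cong)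
    finally show ?thesis
      using s form[OF w] scalar_prod_self_pos[OF w False] by (simp add: field_simps)
  qed
  have vv: "v \<bullet> v = 1"
    using f by (auto simp: v_def scalar_prod_def K_def power2_eq_square lessThan_atLeast0)
  have vAv: "v \<bullet> (A *\<^sub>v v) = \<mu>"
    using form[OF v] by (simp add: \<mu>_def q_def v_def)
  define M where "M = A - \<mu> \<cdot>\<^sub>m 1\<^sub>m m"
  have M: "M \<in> carrier_mat m m" using A by (auto simp: M_def intro!: minus_carrier_mat)
  have Mw: "M *\<^sub>v w = A *\<^sub>v w - \<mu> \<cdot>\<^sub>v w" if "w \<in> carrier_vec m" for w
    using A that by (simp add: M_def minus_mult_distrib_mat_vec[of _ m m] smult_mat_mult_vec[of _ m m])
  have Mform: "w \<bullet> (M *\<^sub>v w) = w \<bullet> (A *\<^sub>v w) - \<mu> * (w \<bullet> w)" if "w \<in> carrier_vec m" for w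
    using A that by (simp add: Mw scalar_prod_minus_distrib[of _ m])
  have "transpose_mat M = M"
    using A transpose_minus[of A m m "\<mu> \<cdot>\<^sub>m 1\<^sub>m m"] by (simp add: M_def transpose_smult_one)
  then have "M *\<^sub>v v = 0\<^sub>v m"
  proof (rule psd_form_zero_imp_kernel[OF M _ _ v])
    show "0 \<le> w \<bullet> (M *\<^sub>v w)" if "w \<in> carrier_vec m" for w
      unfolding Mform[OF that] using le[OF that] by linarith
    show "v \<bullet> (M *\<^sub>v v) = 0" unfolding Mform[OF v] vAv vv by simp
  qed
  then have "A *\<^sub>v v - \<mu> \<cdot>\<^sub>v v = 0\<^sub>v m" using v by (simp add: Mw)
  then have "(A *\<^sub>v v - \<mu> \<cdot>\<^sub>v v) $ i = 0" if "i < m" for i using that by simp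
  then have "A *\<^sub>v v = \<mu> \<cdot>\<^sub>v v" using A v by (intro eq_vecI) auto
  moreover have "v \<noteq> 0\<^sub>v m" using vv by auto
  ultimately have "eigenvector A v \<mu>" using A v by (simp add: eigenvector_def)
  then have "eigenvalue A \<mu>" unfolding eigenvalue_def by blast
  then show ?thesis using le by blast
qed

text \<open>The \<open>N - m\<close> smallest eigenvalues of \<open>R R\<^sup>T\<close> are zeros split off by the factor
  \<open>x ^ (N - m)\<close> of the characteristic polynomial; the next one is the least eigenvalue of \<open>R\<^sup>T R\<close>.\<close>

lemma nth_eigenvalue_gram:
  fixes R :: "real mat"
  assumes R: "R \<in> carrier_mat N m" and m: "0 < m" "m \<le> N"
  defines "\<nu> \<equiv> nth_eigenvalue (N - m + 1) (R * transpose_mat R)"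
  shows "eigenvalue (transpose_mat R * R) \<nu>"
    and "\<And>w. w \<in> carrier_vec m \<Longrightarrow> \<nu> * (w \<bullet> w) \<le> (R *\<^sub>v w) \<bullet> (R *\<^sub>v w)"
proof -
  define G where "G = transpose_mat R * R"
  have G: "G \<in> carrier_mat m m" "transpose_mat G = G"
    using R by (auto simp: G_def transpose_mult[of _ m N])
  have form: "w \<bullet> (G *\<^sub>v w) = (R *\<^sub>v w) \<bullet> (R *\<^sub>v w)" if w: "w \<in> carrier_vec m" for w
    using gram_form[OF R w] by (simp add: G_def)
  define S where "S = proots (char_poly G)"
  have S: "k \<in># S \<longleftrightarrow> eigenvalue G k" for k
    using eigenvalue_root_char_poly[OF G(1)] char_poly_nonzero[OF G(1)] by (simp add: S_def)
  obtain \<mu> where \<mu>: "eigenvalue G \<mu>" "\<And>w. w \<in> carrier_vec m \<Longrightarrow> \<mu> * (w \<bullet> w) \<le> w \<bullet> (G *\<^sub>v w)"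
    using symmetric_min_eigenvalue[OF G m(1)] by blast
  have "proots (char_poly (R * transpose_mat R)) = replicate_mset (N - m) 0 + S"
    unfolding S_def G_def using R m by (intro proots_char_poly_mult_swap) auto
  \<comment> \<open>A Gram matrix has no negative eigenvalue, so the additional zeros sort to the
    front.\<close>
  moreover have "sorted_list_of_multiset (replicate_mset (N - m) 0 + S)
      = replicate (N - m) 0 @ sorted_list_of_multiset S"
    using eigenvalue_gram_nonneg[OF R] S
    by (intro sorted_list_of_multiset_replicate_plus) (auto simp: G_def)
  \<comment> \<open>\<open>nth_eigenvalue\<close> counts from 1, so the index
    \<open>N - m + 1\<close> is the list position right after the \<open>N - m\<close>
    zeros.\<close>
  ultimately have "\<nu> = (replicate (N - m) 0 @ sorted_list_of_multiset S) ! (N - m)"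
    by (simp add: \<nu>_def nth_eigenvalue_def)
  then have \<nu>: "\<nu> = sorted_list_of_multiset S ! 0" by (simp add: nth_append)
  \<comment> \<open>The real eigenvalue \<open>\<mu>\<close> guarantees that the list of real roots
    is nonempty, so that its position 0 is meaningful.\<close>
  have "\<mu> \<in> set (sorted_list_of_multiset S)" using \<mu>(1) S by simp
  then have ne: "sorted_list_of_multiset S \<noteq> []" by (metis empty_iff list.set(1))
  have "sorted_list_of_multiset S ! 0 \<in> set (sorted_list_of_multiset S)" using ne by (intro nth_mem) simp
  then have mem: "\<nu> \<in># S" unfolding \<nu> by simp
  have min: "\<nu> \<le> k" if "k \<in># S" for k
  proof -
    have "k \<in> set (sorted_list_of_multiset S)" using that by simp
    then obtain i where "i < length (sorted_list_of_multiset S)" "sorted_list_of_multiset S ! i = k"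
      unfolding in_set_conv_nth by blast
    then show ?thesis unfolding \<nu> using sorted_nth_mono[of "sorted_list_of_multiset S" 0 i] by simp
  qed
  show "eigenvalue (transpose_mat R * R) \<nu>" using mem S by (simp add: G_def)
  show "\<nu> * (w \<bullet> w) \<le> (R *\<^sub>v w) \<bullet> (R *\<^sub>v w)" if w: "w \<in> carrier_vec m" for w
  proof -
    have "\<nu> * (w \<bullet> w) \<le> \<mu> * (w \<bullet> w)"
      by (intro mult_right_mono min scalar_prod_self_nonneg) (simp add: S \<mu>(1))
    also have "\<dots> \<le> (R *\<^sub>v w) \<bullet> (R *\<^sub>v w)" using \<mu>(2)[OF w] unfolding form[OF w] .
    finally show ?thesis .
  qed
qed

section \<open>Edge weights and the rigidity matrix\<close>

definition nbrs :: "'a graph \<Rightarrow> 'a \<Rightarrow> 'a set" where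
  "nbrs G x = {y. {x, y} \<in> edges G}"

lemma simple_graphD:
  assumes "simple_graph G"
  shows "finite (verts G)" "finite (edges G)" "{x, y} \<in> edges G \<Longrightarrow> x \<in> verts G \<and> y \<in> verts G \<and> x \<noteq> y"
    "nbrs G x \<subseteq> verts G" "finite (nbrs G x)"
proof -
  show f: "finite (verts G)" using assms by (simp add: simple_graph_def)
  have "edges G \<subseteq> Pow (verts G)" using assms by (auto simp: simple_graph_def)
  then show "finite (edges G)" using f by (meson finite_Pow_iff finite_subset)
  show *: "x \<in> verts G \<and> y \<in> verts G \<and> x \<noteq> y" if "{x, y} \<in> edges G" for x y
    using that assms by (force simp: simple_graph_def)
  show "nbrs G x \<subseteq> verts G" using * by (auto simp: nbrs_def)
  then show "finite (nbrs G x)" using f by (rule finite_subset)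
qed

lemma image_nbrs:
  assumes G: "simple_graph G"
  shows "(\<lambda>y. {x, y}) ` nbrs G x = {e \<in> edges G. x \<in> e}"
proof -
  have "e \<in> (\<lambda>y. {x, y}) ` nbrs G x" if e: "e \<in> edges G" "x \<in> e" for e
  proof -
    obtain a b where "e = {a, b}" using G e by (auto simp: simple_graph_def card_2_iff)
    then show ?thesis using e by (auto simp: nbrs_def image_iff insert_commute)
  qed
  then show ?thesis by (auto simp: nbrs_def)
qed

lemma sum_nbrs:
  assumes G: "simple_graph G"
  shows "(\<Sum>y\<in>nbrs G x. h {x, y}) = (\<Sum>e | e \<in> edges G \<and> x \<in> e. h e)"
proof -
  have "inj_on (\<lambda>y. {x, y}) (nbrs G x)" by (auto simp: inj_on_def doubleton_eq_iff)
  then show ?thesis unfolding image_nbrs[OF G, symmetric] by (simp add: sum.reindex)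
qed

section \<open>Enumerations of vertices and edges\<close>

lemma vert_list:
  assumes "simple_graph G"
  shows "distinct (vert_list G)" "set (vert_list G) = verts G" "length (vert_list G) = card (verts G)"
proof -
  have "\<exists>vs. distinct vs \<and> set vs = verts G"
    using simple_graphD(1)[OF assms] finite_distinct_list by blast
  then have *: "distinct (vert_list G) \<and> set (vert_list G) = verts G"
    unfolding vert_list_def by (rule someI_ex)
  then show "distinct (vert_list G)" "set (vert_list G) = verts G" by auto
  then show "length (vert_list G) = card (verts G)" by (metis distinct_card)
qed

abbreviation ends :: "'a \<times> 'a \<Rightarrow> 'a set" where "ends \<equiv> (\<lambda>(u, v). {u, v})"

lemma edge_list:
  assumes "simple_graph G"
  shows "distinct (map ends (edge_list G))" "ends ` set (edge_list G) = edges G"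
    "length (edge_list G) = card (edges G)"
proof -
  \<comment> \<open>A witness for the \<open>SOME\<close> in \<open>edge_list\<close>: enumerate the
    edges as sets, then let \<open>h\<close> put the two ends of each in some order.\<close>
  obtain es where es: "distinct es" "set es = edges G"
    using simple_graphD(2)[OF assms] finite_distinct_list by blast
  have "\<exists>q. ends q = e" if "e \<in> edges G" for e
    using that assms by (fastforce simp: simple_graph_def card_2_iff)
  then obtain h where h: "\<And>e. e \<in> edges G \<Longrightarrow> ends (h e) = e" by metis
  then have "map (ends \<circ> h) es = es" using es by (intro map_idI) auto
  then have "distinct (map ends (map h es)) \<and> set (map ends (map h es)) = edges G"
    using es by simp
  then have *: "distinct (map ends (edge_list G)) \<and> set (map ends (edge_list G)) = edges G"
    unfolding edge_list_def by (rule someI)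
  then show "distinct (map ends (edge_list G))" "ends ` set (edge_list G) = edges G" by auto
  then show "length (edge_list G) = card (edges G)"
    by (metis distinct_card length_map list.set_map)
qed

lemma edge_list_mem:
  assumes "simple_graph G" "(u, v) \<in> set (edge_list G)"
  shows "{u, v} \<in> edges G"
  using edge_list(2)[OF assms(1)] assms(2) by force

lemma bij_betw_edge_list:
  assumes "simple_graph G"
  shows "bij_betw (\<lambda>k. ends (edge_list G ! k)) {..<card (edges G)} (edges G)"
proof -
  have "bij_betw ((!) (map ends (edge_list G))) {..<card (edges G)} (edges G)"
    using edge_list[OF assms] by (intro bij_betw_nth) auto
  moreover have "map ends (edge_list G) ! k = ends (edge_list G ! k)" if "k < card (edges G)" for k
    using that edge_list(3)[OF assms] by simp
  ultimately show ?thesis by (subst (asm) bij_betw_cong) auto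
qed

section \<open>Coordinates of edge directions and rows of the rigidity matrix\<close>

lemma dim_edge_dir:
  assumes "p u \<in> carrier_vec d" "p v \<in> carrier_vec d"
  shows "edge_dir p u v \<in> carrier_vec d"
  using assms by (auto simp: edge_dir_def)

text \<open>Coinciding end positions are covered too: the numerator is then 0, in agreement with the
  zero direction.\<close>

lemma edge_dir_index:
  assumes "p u \<in> carrier_vec d" "p v \<in> carrier_vec d" "c < d"
  shows "edge_dir p u v $ c = (p u $ c - p v $ c) / vec_len (p u - p v)"
  using assms by (auto simp: edge_dir_def)

lemma vec_len_sum:
  assumes "x \<in> carrier_vec d"
  shows "vec_len x = sqrt (\<Sum>c<d. (x $ c)\<^sup>2)"
  using assms by (auto simp: vec_len_def scalar_prod_self)

lemma vec_len_minus_commute: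
  assumes "x \<in> carrier_vec d" "y \<in> carrier_vec d"
  shows "vec_len (x - y) = vec_len (y - x)"
  using assms by (subst (1 2) vec_len_sum[of _ d]) (auto simp: power2_commute)

lemma edge_dir_swap:
  assumes "p u \<in> carrier_vec d" "p v \<in> carrier_vec d" "c < d"
  shows "edge_dir p v u $ c = - edge_dir p u v $ c"
  unfolding edge_dir_index[of p v d u c, OF assms(2,1,3)] edge_dir_index[of p u d v c, OF assms]
    vec_len_minus_commute[OF assms(2,1)] by (simp add: diff_divide_distrib)

text \<open>In the Kronecker layout, row \<open>i\<close> belongs to vertex number
  \<open>i div d\<close> and coordinate \<open>i mod d\<close>; sums over rows thus become sums over
  vertices and coordinates.\<close>

lemma sum_div_mod:
  fixes f :: "nat \<Rightarrow> nat \<Rightarrow> 'b :: comm_monoid_add"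
  shows "(\<Sum>i<d * n. f (i div d) (i mod d)) = (\<Sum>a<n. \<Sum>c<d. f a c)"
proof -
  have *: "a * d + c < d * n" if "a < n" "c < d" for a c :: nat
  proof -
    have "a * d + c < (a + 1) * d" using that by simp
    also have "\<dots> \<le> n * d" using that by (intro mult_right_mono) auto
    finally show ?thesis by (simp add: mult.commute)
  qed
  have "(\<Sum>i<d * n. f (i div d) (i mod d)) = (\<Sum>(a, c)\<in>{..<n} \<times> {..<d}. f a c)"
    by (rule sum.reindex_bij_witness[of _ "\<lambda>(a, c). a * d + c" "\<lambda>i. (i div d, i mod d)"])
      (use * in \<open>auto simp: less_mult_imp_div_less mult.commute intro!: mod_less_divisor gr0I\<close>)
  then show ?thesis by (simp add: sum.cartesian_product)
qed

text \<open>This is \<open>|R \<omega>|^2\<close> free of enumerations: the inner sum is coordinate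
  \<open>c\<close> of \<open>R \<omega>\<close> at the vertex \<open>x\<close>. Each edge direction
  is taken as seen from \<open>x\<close>, so no orientation of the edges is needed.\<close>

definition stress_form :: "nat \<Rightarrow> 'a graph \<Rightarrow> ('a \<Rightarrow> real vec) \<Rightarrow> ('a set \<Rightarrow> real) \<Rightarrow> real" where
  "stress_form d G p \<omega> = (\<Sum>x\<in>verts G. \<Sum>c<d. (\<Sum>y\<in>nbrs G x. \<omega> {x, y} * edge_dir p x y $ c)\<^sup>2)"

text \<open>The column stored as \<open>(u, v)\<close> contributes its direction at \<open>u\<close>
  and the negative at \<open>v\<close>. The latter is the direction from \<open>v\<close> to
  \<open>u\<close>, so either way \<open>x\<close> sees \<open>edge_dir p x y\<close>, whatever the
  stored order.\<close>

lemma sum_incident_edges: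
  assumes G: "simple_graph G" and p: "p \<in> placements d G" and c: "c < d"
  shows "(\<Sum>k<card (edges G). case edge_list G ! k of (u, v) \<Rightarrow>
            \<omega> {u, v} * (((if x = u then 1 else 0) - (if x = v then 1 else 0)) * edge_dir p u v $ c))
       = (\<Sum>y\<in>nbrs G x. \<omega> {x, y} * edge_dir p x y $ c)"
proof -
  \<comment> \<open>The definite description recovers the end of \<open>e\<close> other than
    \<open>x\<close>, which makes the summand a function of the unordered edge.\<close>
  define h where "h e = (if x \<in> e then \<omega> e * edge_dir p x (THE y. e = {x, y}) $ c else 0)" for e
  have the: "(THE y. {a, b} = {a, y}) = b" for a b :: 'a
    by (rule the_equality) (auto simp: doubleton_eq_iff)
  have hxy: "h {x, y} = \<omega> {x, y} * edge_dir p x y $ c" for y by (simp add: h_def the)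
  have "(case edge_list G ! k of (u, v) \<Rightarrow>
            \<omega> {u, v} * (((if x = u then 1 else 0) - (if x = v then 1 else 0)) * edge_dir p u v $ c))
       = h (ends (edge_list G ! k))" if k: "k < card (edges G)" for k
  proof -
    obtain u v where uv: "edge_list G ! k = (u, v)" by fastforce
    then have "{u, v} \<in> edges G" using edge_list_mem[OF G] edge_list(3)[OF G] k by (metis nth_mem)
    note e = simple_graphD(3)[OF G this]
    then have pc: "p u \<in> carrier_vec d" "p v \<in> carrier_vec d" using p by (auto simp: placements_def)
    consider "x = u" | "x = v" "x \<noteq> u" | "x \<noteq> u" "x \<noteq> v" by blast
    then show ?thesis
    proof cases
      case 1
      then show ?thesis using e hxy[of v] uv by auto
    next
      case 2
      then show ?thesis using e hxy[of u] uv edge_dir_swap[of p u d v c] pc c by (auto simp: insert_commute)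
    next
      case 3
      then show ?thesis by (simp add: uv h_def)
    qed
  qed
  then have "(\<Sum>k<card (edges G). case edge_list G ! k of (u, v) \<Rightarrow>
            \<omega> {u, v} * (((if x = u then 1 else 0) - (if x = v then 1 else 0)) * edge_dir p u v $ c))
      = (\<Sum>k<card (edges G). h (ends (edge_list G ! k)))"
    by (intro sum.cong) auto
  also have "\<dots> = (\<Sum>e\<in>edges G. h e)" by (rule sum.reindex_bij_betw[OF bij_betw_edge_list[OF G]])
  also have "\<dots> = (\<Sum>e | e \<in> edges G \<and> x \<in> e. h e)"
    using simple_graphD(2)[OF G] by (intro sum.mono_neutral_right) (auto simp: h_def)
  also have "\<dots> = (\<Sum>y\<in>nbrs G x. h {x, y})" by (rule sum_nbrs[OF G, symmetric])
  finally show ?thesis by (simp add: hxy)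
qed

lemma rigidity_mat_carrier:
  assumes "simple_graph G"
  shows "rigidity_mat d G p \<in> carrier_mat (d * card (verts G)) (card (edges G))"
  using edge_list(3)[OF assms] by (simp add: rigidity_mat_def mat_of_cols_def)

text \<open>The dictionary between vectors indexed by the edge enumeration and weights on edges;
  through it the estimates for stars, 4-cycles and \<open>S_graph\<close> need only
  \<open>stress_form\<close>.\<close>

lemma rigidity_mat_form:
  fixes \<omega> :: "'a set \<Rightarrow> real"
  assumes G: "simple_graph G" and p: "p \<in> placements d G"
  defines "w \<equiv> vec (card (edges G)) (\<lambda>k. \<omega> (ends (edge_list G ! k)))"
  shows "(rigidity_mat d G p *\<^sub>v w) \<bullet> (rigidity_mat d G p *\<^sub>v w) = stress_form d G p \<omega>"
    and "w \<bullet> w = (\<Sum>e\<in>edges G. (\<omega> e)\<^sup>2)"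
proof -
  let ?R = "rigidity_mat d G p" and ?n = "card (verts G)" and ?m = "card (edges G)"
  have R: "?R \<in> carrier_mat (d * ?n) ?m" by (rule rigidity_mat_carrier[OF G])
  have entry: "?R $$ (i, k) = (case edge_list G ! k of (u, v) \<Rightarrow>
      ((if vert_list G ! (i div d) = u then 1 else 0) - (if vert_list G ! (i div d) = v then 1 else 0))
        * edge_dir p u v $ (i mod d))"
    if i: "i < d * ?n" and k: "k < ?m" for i k
  proof -
    obtain u v where uv: "edge_list G ! k = (u, v)" by fastforce
    then have "{u, v} \<in> edges G" using edge_list_mem[OF G] edge_list(3)[OF G] k by (metis nth_mem)
    note e = simple_graphD(3)[OF G this]
    then have "edge_dir p u v \<in> carrier_vec d"
      using p by (intro dim_edge_dir) (auto simp: placements_def)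
    then have dim: "dim_vec (edge_dir p u v) = d" by auto
    have "i div d < ?n" using i by (simp add: less_mult_imp_div_less mult.commute)
    then show ?thesis
      using i k uv edge_list(3)[OF G] dim
      by (simp add: rigidity_mat_def mat_of_cols_index kron_vec_def vert_unit_def mult.commute[of d])
  qed
  define S where "S a c = (\<Sum>y\<in>nbrs G (vert_list G ! a). \<omega> {vert_list G ! a, y} * edge_dir p (vert_list G ! a) y $ c)" for a c
  have Rw: "(?R *\<^sub>v w) $ i = S (i div d) (i mod d)" if i: "i < d * ?n" for i
  proof -
    have "i mod d < d" using i by (cases d) auto
    note sum_incident_edges[OF G p this, of \<omega> "vert_list G ! (i div d)", folded S_def]
    moreover have "(?R *\<^sub>v w) $ i = (\<Sum>k<?m. ?R $$ (i, k) * \<omega> (ends (edge_list G ! k)))"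
      using R i by (auto simp: w_def scalar_prod_def lessThan_atLeast0)
    moreover have "\<dots> = (\<Sum>k<?m. case edge_list G ! k of (u, v) \<Rightarrow>
            \<omega> {u, v} * (((if vert_list G ! (i div d) = u then 1 else 0) - (if vert_list G ! (i div d) = v then 1 else 0)) * edge_dir p u v $ (i mod d)))"
      using i by (intro sum.cong) (auto simp: entry split: prod.splits)
    ultimately show ?thesis by simp
  qed
  have "(?R *\<^sub>v w) \<bullet> (?R *\<^sub>v w) = (\<Sum>i<d * ?n. (S (i div d) (i mod d))\<^sup>2)"
    using R Rw by (auto simp: scalar_prod_self intro!: sum.cong)
  also have "\<dots> = (\<Sum>a<?n. \<Sum>c<d. (S a c)\<^sup>2)" by (rule sum_div_mod)
  also have "\<dots> = stress_form d G p \<omega>"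
    unfolding S_def stress_form_def
    by (rule sum.reindex_bij_betw[OF bij_betw_nth, where g = "\<lambda>x. \<Sum>c<d. (\<Sum>y\<in>nbrs G x. \<omega> {x, y} * edge_dir p x y $ c)\<^sup>2"])
       (use vert_list[OF G] in auto)
  finally show "(?R *\<^sub>v w) \<bullet> (?R *\<^sub>v w) = stress_form d G p \<omega>" .
  show "w \<bullet> w = (\<Sum>e\<in>edges G. (\<omega> e)\<^sup>2)"
    using sum.reindex_bij_betw[OF bij_betw_edge_list[OF G], of "\<lambda>e. (\<omega> e)\<^sup>2"]
    by (simp add: scalar_prod_self w_def)
qed

text \<open>The weights serve as a test vector in the Rayleigh bound for the least eigenvalue of
  \<open>R\<^sup>T R\<close>, and dividing by the positive \<open>|\<omega>|^2\<close> gives the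
  claim.\<close>

lemma nth_eigenvalue_stiffness_le_1:
  assumes G: "simple_graph G" and p: "p \<in> placements d G" and le: "card (edges G) \<le> d * card (verts G)"
    and e: "e \<in> edges G" "\<omega> e \<noteq> 0"
    and form: "stress_form d G p \<omega> \<le> (\<Sum>e\<in>edges G. (\<omega> e)\<^sup>2)"
  shows "nth_eigenvalue (d * card (verts G) - card (edges G) + 1) (stiffness_mat d G p) \<le> 1"
proof -
  let ?N = "d * card (verts G)" and ?m = "card (edges G)"
  define w where "w = vec ?m (\<lambda>k. \<omega> (ends (edge_list G ! k)))"
  have m: "0 < ?m" using e simple_graphD(2)[OF G] by (auto simp: card_gt_0_iff)
  have "w \<in> carrier_vec ?m" by (simp add: w_def)
  from nth_eigenvalue_gram(2)[OF rigidity_mat_carrier[OF G, of d p] m le this, folded stiffness_mat_def]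
  have "nth_eigenvalue (?N - ?m + 1) (stiffness_mat d G p) * (\<Sum>e\<in>edges G. (\<omega> e)\<^sup>2) \<le> 1 * (\<Sum>e\<in>edges G. (\<omega> e)\<^sup>2)"
    using form unfolding rigidity_mat_form[OF G p, of \<omega>, folded w_def] by linarith
  moreover have "(\<Sum>e\<in>edges G. (\<omega> e)\<^sup>2) > 0"
    using e simple_graphD(2)[OF G] by (intro sum_pos2[of _ e]) auto
  ultimately show ?thesis by (simp only: mult_le_cancel_right_pos)
qed

text \<open>Here the hypothesis is applied to an eigenvector \<open>w\<close> for the least
  eigenvalue of \<open>R\<^sup>T R\<close>, where the form equals that eigenvalue times
  \<open>|w|^2\<close>.\<close>

lemma nth_eigenvalue_stiffness_ge_1:
  assumes G: "simple_graph G" and p: "p \<in> placements d G" and le: "card (edges G) \<le> d * card (verts G)"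
    and ne: "edges G \<noteq> {}"
    and form: "\<And>\<omega>. (\<Sum>e\<in>edges G. (\<omega> e)\<^sup>2) \<le> stress_form d G p \<omega>"
  shows "nth_eigenvalue (d * card (verts G) - card (edges G) + 1) (stiffness_mat d G p) \<ge> 1"
proof -
  let ?N = "d * card (verts G)" and ?m = "card (edges G)"
  let ?\<nu> = "nth_eigenvalue (?N - ?m + 1) (stiffness_mat d G p)"
  have m: "0 < ?m" using ne simple_graphD(2)[OF G] by (auto simp: card_gt_0_iff)
  have R: "rigidity_mat d G p \<in> carrier_mat ?N ?m" by (rule rigidity_mat_carrier[OF G])
  obtain w where w: "w \<in> carrier_vec ?m" "w \<noteq> 0\<^sub>v ?m"
    "(rigidity_mat d G p *\<^sub>v w) \<bullet> (rigidity_mat d G p *\<^sub>v w) = ?\<nu> * (w \<bullet> w)"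
    using eigenvalue_gram_vector[OF R nth_eigenvalue_gram(1)[OF R m le], folded stiffness_mat_def] by blast
  \<comment> \<open>The eigenvector is read back as weights on edges through the inverse of the edge
    enumeration.\<close>
  define \<omega> where "\<omega> e = w $ (the_inv_into {..<?m} (\<lambda>k. ends (edge_list G ! k)) e)" for e
  have inj: "inj_on (\<lambda>k. ends (edge_list G ! k)) {..<?m}"
    using bij_betw_edge_list[OF G] by (rule bij_betw_imp_inj_on)
  have "w = vec ?m (\<lambda>k. \<omega> (ends (edge_list G ! k)))"
  proof (rule eq_vecI)
    fix k assume "k < dim_vec (vec ?m (\<lambda>k. \<omega> (ends (edge_list G ! k))))"
    then have "k < ?m" by simp
    then show "w $ k = vec ?m (\<lambda>k. \<omega> (ends (edge_list G ! k))) $ k"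
      using the_inv_into_f_f[OF inj, of k] by (simp add: \<omega>_def)
  qed (use w in simp)
  from rigidity_mat_form[OF G p, of \<omega>, folded this] form[of \<omega>]
  have "1 * (w \<bullet> w) \<le> ?\<nu> * (w \<bullet> w)" using w(3) by simp
  then show ?thesis using scalar_prod_self_pos[OF w(1,2)] by (simp only: mult_le_cancel_right_pos)
qed

text \<open>Weighted handshake by exchanging the sums, as every edge has two ends. Values lie in a
  general semiring because it serves both for squared real weights and for counting degrees in the
  naturals.\<close>

lemma sum_nbrs_handshake:
  fixes h :: "'a set \<Rightarrow> 'b :: comm_semiring_1"
  assumes G: "simple_graph G"
  shows "(\<Sum>x\<in>verts G. \<Sum>y\<in>nbrs G x. h {x, y}) = 2 * (\<Sum>e\<in>edges G. h e)"
proof -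
  have "(\<Sum>x\<in>verts G. \<Sum>y\<in>nbrs G x. h {x, y}) = (\<Sum>x\<in>verts G. \<Sum>e | e \<in> edges G \<and> x \<in> e. h e)"
    by (simp add: sum_nbrs[OF G])
  also have "\<dots> = (\<Sum>e\<in>edges G. \<Sum>x | x \<in> verts G \<and> x \<in> e. h e)"
    using simple_graphD(1,2)[OF G] by (rule sum.swap_restrict)
  also have "\<dots> = (\<Sum>e\<in>edges G. 2 * h e)"
  proof (rule sum.cong)
    fix e assume "e \<in> edges G"
    then have "{x. x \<in> verts G \<and> x \<in> e} = e" "card e = 2" using G by (auto simp: simple_graph_def)
    then show "(\<Sum>x | x \<in> verts G \<and> x \<in> e. h e) = 2 * h e" by simp
  qed simp
  finally show ?thesis by (simp add: sum_distrib_left)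
qed

section \<open>Upper bound: weights on stars and on \<open>K\<^sub>4\<close>\<close>

text \<open>Gaussian elimination by induction on the number of equations: the last equation either
  vanishes identically or lets one unknown \<open>z\<close> be eliminated.\<close>

lemma homogeneous_system_solution:
  fixes f :: "'b \<Rightarrow> nat \<Rightarrow> real"
  assumes "finite Y" "d < card Y"
  shows "\<exists>c. (\<exists>y\<in>Y. c y \<noteq> 0) \<and> (\<forall>i<d. (\<Sum>y\<in>Y. c y * f y i) = 0)"
  using assms
proof (induction d arbitrary: f Y)
  case 0
  then have "Y \<noteq> {}" by auto
  then show ?case by (intro exI[of _ "\<lambda>_. 1"]) auto
next
  case (Suc d)
  show ?case
  proof (cases "\<forall>y\<in>Y. f y d = 0")
    case True
    obtain c where c: "\<exists>y\<in>Y. c y \<noteq> 0" "\<forall>i<d. (\<Sum>y\<in>Y. c y * f y i) = 0"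
      using Suc.IH[of Y f] Suc.prems by auto
    have "(\<Sum>y\<in>Y. c y * f y d) = 0" using True by simp
    then show ?thesis using c less_Suc_eq by blast
  next
    case False
    then obtain z where z: "z \<in> Y" "f z d \<noteq> 0" by blast
    define Y' where "Y' = Y - {z}"
    have Y': "finite Y'" "Y = insert z Y'" "z \<notin> Y'" "d < card Y'"
      using z Suc.prems by (auto simp: Y'_def)
    \<comment> \<open>These are the coefficients after substituting for the unknown of
      \<open>z\<close> its expression from equation \<open>d\<close>; those of equation
      \<open>d\<close> itself become 0.\<close>
    obtain c where c: "\<exists>y\<in>Y'. c y \<noteq> 0"
      "\<And>i. i < d \<Longrightarrow> (\<Sum>y\<in>Y'. c y * (f y i - f y d / f z d * f z i)) = 0"
      using Suc.IH[of Y' "\<lambda>y i. f y i - f y d / f z d * f z i"] Y' by blast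
    \<comment> \<open>The value that equation \<open>d\<close> forces on the eliminated
      unknown.\<close>
    define s where "s = - (\<Sum>y\<in>Y'. c y * f y d) / f z d"
    have eq: "(\<Sum>y\<in>Y'. c y * (f y i - f y d / f z d * f z i)) = (\<Sum>y\<in>Y'. c y * f y i) + s * f z i" for i
      by (simp add: s_def algebra_simps sum_subtractf sum_divide_distrib sum_distrib_left sum_distrib_right)
    define c' where "c' = c(z := s)"
    have sum: "(\<Sum>y\<in>Y. c' y * f y i) = (\<Sum>y\<in>Y'. c y * f y i) + s * f z i" for i
    proof -
      have "(\<Sum>y\<in>Y'. c' y * f y i) = (\<Sum>y\<in>Y'. c y * f y i)"
        using Y'(3) by (intro sum.cong) (auto simp: c'_def)
      then show ?thesis using Y' by (simp add: c'_def)
    qed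
    have "(\<Sum>y\<in>Y. c' y * f y i) = 0" if "i < Suc d" for i
    proof (cases "i = d")
      case True
      then show ?thesis using z eq[of d] by (simp add: sum)
    next
      case False
      then show ?thesis using that c(2)[of i] eq[of i] by (simp add: sum)
    qed
    moreover have "\<exists>y\<in>Y. c' y \<noteq> 0" using c(1) Y' by (auto simp: c'_def)
    ultimately show ?thesis by blast
  qed
qed

lemma vec_len_square:
  assumes "x \<in> carrier_vec d"
  shows "(vec_len x)\<^sup>2 = (\<Sum>c<d. (x $ c)\<^sup>2)"
  using assms by (simp add: vec_len_sum[of _ d] sum_nonneg)

text \<open>Equality can fail only through the zero direction of an edge whose ends
  coincide.\<close>

lemma edge_dir_norm_le_1:
  assumes "p u \<in> carrier_vec d" "p v \<in> carrier_vec d"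
  shows "(\<Sum>c<d. (edge_dir p u v $ c)\<^sup>2) \<le> 1"
proof -
  have "(\<Sum>c<d. (edge_dir p u v $ c)\<^sup>2) = (\<Sum>c<d. (p u $ c - p v $ c)\<^sup>2) / (vec_len (p u - p v))\<^sup>2"
    unfolding sum_divide_distrib
    using assms by (intro sum.cong) (auto simp: edge_dir_index[of _ _ d] power_divide)
  also have "(\<Sum>c<d. (p u $ c - p v $ c)\<^sup>2) = (vec_len (p u - p v))\<^sup>2"
    using assms by (subst vec_len_square[of _ d]) auto
  finally show ?thesis by simp
qed

text \<open>This is what makes edge lengths good weights: forces become differences of positions,
  and they telescope. When the length is 0 all coordinates agree and both sides vanish.\<close>

lemma vec_len_mult_edge_dir:
  assumes "p u \<in> carrier_vec d" "p v \<in> carrier_vec d" "c < d"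
  shows "vec_len (p u - p v) * edge_dir p u v $ c = p u $ c - p v $ c"
proof (cases "vec_len (p u - p v) = 0")
  case True
  then have "(\<Sum>c<d. ((p u - p v) $ c)\<^sup>2) = 0"
    using assms vec_len_square[of "p u - p v" d] by simp
  then have "((p u - p v) $ c)\<^sup>2 = 0" using assms(3) by (subst (asm) sum_nonneg_eq_0_iff) auto
  then show ?thesis using assms True by auto
next
  case False
  then show ?thesis using assms by (simp add: edge_dir_index[of _ _ d])
qed

text \<open>More than \<open>d\<close> directions in dimension \<open>d\<close> are dependent. A
  dependency, used as weights on the star at \<open>x0\<close>, cancels at the centre, and each leaf
  feels only its own edge, whose direction has norm at most 1.\<close>

lemma stress_star:
  assumes G: "simple_graph G" and p: "p \<in> placements d G" and deg: "d < card (nbrs G x0)"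
  shows "\<exists>\<omega>. (\<exists>e\<in>edges G. \<omega> e \<noteq> 0) \<and> stress_form d G p \<omega> \<le> (\<Sum>e\<in>edges G. (\<omega> e)\<^sup>2)"
proof -
  obtain b where b: "\<exists>y\<in>nbrs G x0. b y \<noteq> 0"
    "\<And>c. c < d \<Longrightarrow> (\<Sum>y\<in>nbrs G x0. b y * edge_dir p x0 y $ c) = 0"
    using homogeneous_system_solution[OF simple_graphD(5)[OF G] deg, of "\<lambda>y c. edge_dir p x0 y $ c"] by blast
  define \<omega> where "\<omega> e = (if x0 \<in> e then b (THE y. e = {x0, y}) else 0)" for e
  have \<omega>: "\<omega> {x0, y} = b y" for y
  proof -
    have "(THE z. {x0, y} = {x0, z}) = y" by (rule the_equality) (auto simp: doubleton_eq_iff)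
    then show ?thesis by (simp add: \<omega>_def)
  qed
  define F where "F x = (\<Sum>c<d. (\<Sum>y\<in>nbrs G x. \<omega> {x, y} * edge_dir p x y $ c)\<^sup>2)" for x
  have x0: "x0 \<in> verts G" using b(1) simple_graphD(3)[OF G] by (auto simp: nbrs_def)
  have "F x0 = 0" using b(2) by (simp add: F_def \<omega>)
  have F_nbr: "F x \<le> (b x)\<^sup>2" if x: "x \<in> nbrs G x0" for x
  proof -
    have nx: "x0 \<in> nbrs G x" "x \<noteq> x0" using x simple_graphD(3)[OF G, of x0 x] by (auto simp: nbrs_def insert_commute)
    have pc: "p x \<in> carrier_vec d" "p x0 \<in> carrier_vec d"
      using p x x0 simple_graphD(4)[OF G] by (auto simp: placements_def)
    \<comment> \<open>At a leaf \<open>x\<close> every edge other than the one to \<open>x0\<close>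
      carries weight 0.\<close>
    have "(\<Sum>y\<in>nbrs G x. \<omega> {x, y} * edge_dir p x y $ c) = b x * edge_dir p x x0 $ c" for c
    proof -
      have "(\<Sum>y\<in>nbrs G x. \<omega> {x, y} * edge_dir p x y $ c) = (\<Sum>y\<in>{x0}. \<omega> {x, y} * edge_dir p x y $ c)"
        using nx simple_graphD(5)[OF G] by (intro sum.mono_neutral_right) (auto simp: \<omega>_def)
      then show ?thesis using \<omega>[of x] by (simp add: insert_commute)
    qed
    then have "F x = (b x)\<^sup>2 * (\<Sum>c<d. (edge_dir p x x0 $ c)\<^sup>2)"
      by (simp add: F_def power_mult_distrib sum_distrib_left)
    also have "\<dots> \<le> (b x)\<^sup>2" using edge_dir_norm_le_1[of p x d x0] pc by (intro mult_left_le) auto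
    finally show ?thesis .
  qed
  have F_other: "F x = 0" if "x \<in> verts G - nbrs G x0" for x
  proof (cases "x = x0")
    case True
    then show ?thesis using \<open>F x0 = 0\<close> by simp
  next
    case False
    have "x0 \<notin> nbrs G x" using that by (auto simp: nbrs_def insert_commute)
    then have "\<omega> {x, y} = 0" if "y \<in> nbrs G x" for y using that \<open>x \<noteq> x0\<close> by (auto simp: \<omega>_def)
    then show ?thesis by (simp add: F_def)
  qed
  have "stress_form d G p \<omega> = (\<Sum>x\<in>nbrs G x0. F x)"
    unfolding stress_form_def F_def[symmetric]
    using simple_graphD(1,4)[OF G] F_other by (intro sum.mono_neutral_right) auto
  also have "\<dots> \<le> (\<Sum>x\<in>nbrs G x0. (b x)\<^sup>2)" by (intro sum_mono F_nbr)
  also have "\<dots> = (\<Sum>e | e \<in> edges G \<and> x0 \<in> e. (\<omega> e)\<^sup>2)"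
    using sum_nbrs[OF G, of "\<lambda>e. (\<omega> e)\<^sup>2" x0] by (simp add: \<omega>)
  also have "\<dots> \<le> (\<Sum>e\<in>edges G. (\<omega> e)\<^sup>2)"
    using simple_graphD(2)[OF G] by (intro sum_mono2) auto
  finally have "stress_form d G p \<omega> \<le> (\<Sum>e\<in>edges G. (\<omega> e)\<^sup>2)" .
  moreover obtain y where "{x0, y} \<in> edges G" "\<omega> {x0, y} \<noteq> 0" using b(1) \<omega> by (auto simp: nbrs_def)
  ultimately show ?thesis by blast
qed

text \<open>An edge of length 0 has a zero column, so weight 1 on that edge alone is
  annihilated.\<close>

lemma stress_collapsed_edge:
  assumes G: "simple_graph G" and p: "p \<in> placements d G" and ab: "{a, b} \<in> edges G" "vec_len (p a - p b) = 0"
  shows "\<exists>\<omega>. (\<exists>e\<in>edges G. \<omega> e \<noteq> 0) \<and> stress_form d G p \<omega> \<le> (\<Sum>e\<in>edges G. (\<omega> e)\<^sup>2)"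
proof -
  define \<omega> where "\<omega> e = (if e = {a, b} then 1 else 0 :: real)" for e
  have pc: "p a \<in> carrier_vec d" "p b \<in> carrier_vec d"
    using simple_graphD(3)[OF G ab(1)] p by (auto simp: placements_def)
  have ba: "vec_len (p b - p a) = 0" using vec_len_minus_commute[OF pc] ab by simp
  have "\<omega> {x, y} * edge_dir p x y $ c = 0" if "c < d" for x y c
    using that pc ab(2) ba by (auto simp: \<omega>_def doubleton_eq_iff edge_dir_index[of _ _ d])
  then have "stress_form d G p \<omega> = 0" by (simp add: stress_form_def)
  also have "0 \<le> (\<Sum>e\<in>edges G. (\<omega> e)\<^sup>2)" by (simp add: sum_nonneg)
  finally show ?thesis using ab(1) by (auto simp: \<omega>_def intro!: exI[of _ \<omega>])
qed

text \<open>The edge lengths, with sign \<open>+\<close> on the opposite pair \<open>ab, uv\<close> and sign \<open>-\<close> on \<open>au, bv\<close>,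
  make the forces at a vertex add up to the difference of the positions of its two neighbours on
  that 4-cycle; these are joined by one of the remaining edges \<open>av, bu\<close>.\<close>

lemma stress_K4_shortest_pair:
  fixes p :: "'a \<Rightarrow> real vec"
  defines "l \<equiv> \<lambda>x y. vec_len (p x - p y)"
  assumes G: "simple_graph G" and p: "p \<in> placements d G"
    and dist: "distinct [a, b, u, v]"
    and K: "\<And>x y. x \<in> {a, b, u, v} \<Longrightarrow> y \<in> {a, b, u, v} \<Longrightarrow> x \<noteq> y \<Longrightarrow> {x, y} \<in> edges G"
    and leA: "(l a v)\<^sup>2 + (l b u)\<^sup>2 \<le> (l a b)\<^sup>2 + (l u v)\<^sup>2"
    and leB: "(l a v)\<^sup>2 + (l b u)\<^sup>2 \<le> (l a u)\<^sup>2 + (l b v)\<^sup>2"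
  shows "\<exists>\<omega>. (\<exists>e\<in>edges G. \<omega> e \<noteq> 0) \<and> stress_form d G p \<omega> \<le> (\<Sum>e\<in>edges G. (\<omega> e)\<^sup>2)"
proof (cases "l a b = 0")
  case True
  \<comment> \<open>The weights in the other case are signed edge lengths, and a positive length of
    \<open>ab\<close> keeps them from all vanishing; length 0 is therefore treated apart.\<close>
  then show ?thesis using K[of a b] dist by (intro stress_collapsed_edge[OF G p, of a b]) (auto simp: l_def)
next
  case False
  define \<omega> where "\<omega> e = (if e = {a, b} then l a b else if e = {u, v} then l u v
     else if e = {a, u} then - l a u else if e = {b, v} then - l b v else 0)" for e
  have V: "{a, b, u, v} \<subseteq> verts G"
    using K[of a b] K[of u v] simple_graphD(3)[OF G] dist by auto
  then have pc: "p x \<in> carrier_vec d" if "x \<in> {a, b, u, v}" for x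
    using p that by (auto simp: placements_def)
  have l_comm: "l x y = l y x" if "x \<in> {a, b, u, v}" "y \<in> {a, b, u, v}" for x y
    unfolding l_def using vec_len_minus_commute[OF pc pc] that by blast
  define F where "F x c = (\<Sum>y\<in>nbrs G x. \<omega> {x, y} * edge_dir p x y $ c)" for x c
  \<comment> \<open>Here \<open>y\<close> is the neighbour along the positive edge and
    \<open>z\<close> the one along the negative edge, so \<open>p x\<close> cancels.\<close>
  have F: "F x c = p z $ c - p y $ c"
    if c: "c < d" and xyz: "x \<in> {a, b, u, v}" "y \<in> {a, b, u, v}" "z \<in> {a, b, u, v}" "distinct [x, y, z]"
      and \<omega>: "\<omega> {x, y} = l x y" "\<omega> {x, z} = - l x z" "\<And>t. t \<noteq> y \<Longrightarrow> t \<noteq> z \<Longrightarrow> \<omega> {x, t} = 0" for x y z c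
  proof -
    have "F x c = (\<Sum>t\<in>{y, z}. \<omega> {x, t} * edge_dir p x t $ c)"
      unfolding F_def using \<omega>(3) xyz K simple_graphD(5)[OF G]
      by (intro sum.mono_neutral_right) (auto simp: nbrs_def)
    also have "\<dots> = l x y * edge_dir p x y $ c - l x z * edge_dir p x z $ c"
      using xyz \<omega>(1,2) by simp
    also have "\<dots> = (p x $ c - p y $ c) - (p x $ c - p z $ c)"
      using vec_len_mult_edge_dir[of p x d y c] vec_len_mult_edge_dir[of p x d z c] pc xyz c
      by (simp add: l_def)
    finally show ?thesis by simp
  qed
  have \<omega>0: "\<omega> {x, t} = 0" if "x \<notin> {a, b, u, v}" for x t
    using that by (auto simp: \<omega>_def doubleton_eq_iff)
  have Fa: "F a c = p u $ c - p b $ c" and Fb: "F b c = p v $ c - p a $ c"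
    and Fu: "F u c = p a $ c - p v $ c" and Fv: "F v c = p b $ c - p u $ c" if "c < d" for c
    using that dist l_comm
    by (intro F; auto simp: \<omega>_def doubleton_eq_iff)+
  have sq: "(\<Sum>c<d. (p x $ c - p y $ c)\<^sup>2) = (l x y)\<^sup>2" if "x \<in> {a, b, u, v}" "y \<in> {a, b, u, v}" for x y
    unfolding l_def using pc[OF that(1)] pc[OF that(2)] by (subst vec_len_square[of _ d]) auto
  have "stress_form d G p \<omega> = (\<Sum>x\<in>{a, b, u, v}. \<Sum>c<d. (F x c)\<^sup>2)"
    unfolding stress_form_def F_def[symmetric] using V simple_graphD(1)[OF G]
    by (intro sum.mono_neutral_right) (auto simp: F_def \<omega>0)
  \<comment> \<open>Each diagonal of the 4-cycle, \<open>av\<close> or \<open>bu\<close>, arises at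
    both ends of the other one, whence the factor 2 below; adding \<open>leA\<close> and
    \<open>leB\<close> then bounds the total by the squared weights.\<close>
  also have "\<dots> = (l u b)\<^sup>2 + (l v a)\<^sup>2 + (l a v)\<^sup>2 + (l b u)\<^sup>2"
    using dist by (simp add: Fa Fb Fu Fv sq)
  also have "\<dots> = 2 * ((l a v)\<^sup>2 + (l b u)\<^sup>2)" using l_comm[of u b] l_comm[of v a] by simp
  also have "\<dots> \<le> (l a b)\<^sup>2 + (l u v)\<^sup>2 + (l a u)\<^sup>2 + (l b v)\<^sup>2" using leA leB by simp
  also have "\<dots> = (\<Sum>e\<in>{{a, b}, {u, v}, {a, u}, {b, v}}. (\<omega> e)\<^sup>2)"
    using dist by (auto simp: \<omega>_def doubleton_eq_iff)
  also have "\<dots> \<le> (\<Sum>e\<in>edges G. (\<omega> e)\<^sup>2)"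
    using simple_graphD(2)[OF G] K dist by (intro sum_mono2) auto
  finally have "stress_form d G p \<omega> \<le> (\<Sum>e\<in>edges G. (\<omega> e)\<^sup>2)" .
  moreover have "\<omega> {a, b} \<noteq> 0" using False by (simp add: \<omega>_def)
  ultimately show ?thesis using K[of a b] dist by auto
qed

text \<open>Of the three perfect matchings, the one with the least sum of squared lengths is taken
  as the pair of diagonals, and the other two form the 4-cycle. The three cases differ by a renaming
  of the vertices.\<close>

lemma stress_K4:
  assumes G: "simple_graph G" and p: "p \<in> placements d G"
    and dist: "distinct [a, b, u, v]"
    and K: "\<And>x y. x \<in> {a, b, u, v} \<Longrightarrow> y \<in> {a, b, u, v} \<Longrightarrow> x \<noteq> y \<Longrightarrow> {x, y} \<in> edges G"
  shows "\<exists>\<omega>. (\<exists>e\<in>edges G. \<omega> e \<noteq> 0) \<and> stress_form d G p \<omega> \<le> (\<Sum>e\<in>edges G. (\<omega> e)\<^sup>2)"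
proof -
  define q where "q x y = (vec_len (p x - p y))\<^sup>2" for x y
  have pc: "p x \<in> carrier_vec d" if "x \<in> {a, b, u, v}" for x
    using p that K[of a b] K[of u v] simple_graphD(3)[OF G] dist by (auto simp: placements_def)
  have q_comm: "q x y = q y x" if "x \<in> {a, b, u, v}" "y \<in> {a, b, u, v}" for x y
    unfolding q_def using vec_len_minus_commute[OF pc pc] that by simp
  have q_comms: "q b a = q a b" "q u a = q a u" "q v a = q a v" "q u b = q b u" "q v b = q b v" "q v u = q u v"
    by (rule q_comm; simp)+
  consider "q a v + q b u \<le> q a b + q u v" "q a v + q b u \<le> q a u + q b v"
    | "q a b + q u v \<le> q a u + q b v" "q a b + q u v \<le> q a v + q b u"
    | "q a u + q b v \<le> q a b + q u v" "q a u + q b v \<le> q a v + q b u" by linarith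
  then show ?thesis
  proof cases
    case 1
    show ?thesis by (rule stress_K4_shortest_pair[OF G p dist K, folded q_def]) (use 1 in auto)
  next
    case 2
    show ?thesis
      by (rule stress_K4_shortest_pair[OF G p, of a u v b, folded q_def]) (use 2 dist q_comms K in auto)
  next
    case 3
    show ?thesis
      by (rule stress_K4_shortest_pair[OF G p, of a b v u, folded q_def]) (use 3 dist q_comms K in auto)
  qed
qed

section \<open>Edge count of minimally rigid graphs\<close>

lemma (in vec_space) lin_indpt_cols_card_rank:
  assumes A: "A \<in> carrier_mat n nc"
  shows "\<exists>U. U \<subseteq> set (cols A) \<and> lin_indpt U \<and> card U = rank A"
proof -
  have "lin_indpt {}" by (meson empty_iff empty_subsetI finite.emptyI finite_lin_indpt2)
  then obtain U where "maximal U (\<lambda>T. T \<subseteq> set (cols A) \<and> lin_indpt T)"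
    using maximal_exists_superset[of "set (cols A)" "\<lambda>T. T \<subseteq> set (cols A) \<and> lin_indpt T" "{}"] by auto
  then show ?thesis using rank_card_indpt[OF A] unfolding maximal_def by metis
qed

lemma (in vec_space) rank_mono_cols:
  assumes A: "A \<in> carrier_mat n nc" and B: "B \<in> carrier_mat n nc'"
    and sub: "set (cols A) \<subseteq> set (cols B)"
  shows "rank A \<le> rank B"
  using lin_indpt_cols_card_rank[OF A] rank_ge_card_indpt[OF B] sub by (metis subset_trans)

text \<open>A graph and the graph with an edge deleted have unrelated edge enumerations, so their
  matrices are compared through the sets of columns. Reversing an edge flips both Kronecker factors,
  so both orders of its ends give the same column.\<close>

lemma cols_rigidity_mat:
  assumes G: "simple_graph G" and p: "p \<in> placements d G"
  shows "set (cols (rigidity_mat d G p))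
    = {kron_vec (vert_unit G u - vert_unit G v) (edge_dir p u v) | u v. {u, v} \<in> edges G}" (is "_ = ?C")
proof -
  let ?k = "\<lambda>(u, v). kron_vec (vert_unit G u - vert_unit G v) (edge_dir p u v)"
  have dim: "edge_dir p u v \<in> carrier_vec d" if "{u, v} \<in> edges G" for u v
    using simple_graphD(3)[OF G that] p by (intro dim_edge_dir) (auto simp: placements_def)
  have swap: "kron_vec (vert_unit G v - vert_unit G u) (edge_dir p v u)
      = kron_vec (vert_unit G u - vert_unit G v) (edge_dir p u v)" if e: "{u, v} \<in> edges G" for u v
  proof (rule eq_vecI)
    have dd: "dim_vec (edge_dir p u v) = d" "dim_vec (edge_dir p v u) = d"
      using dim[of u v] dim[of v u] e by (auto simp: insert_commute)
    then show "dim_vec (kron_vec (vert_unit G v - vert_unit G u) (edge_dir p v u))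
        = dim_vec (kron_vec (vert_unit G u - vert_unit G v) (edge_dir p u v))"
      by (simp add: kron_vec_def vert_unit_def)
    fix i assume "i < dim_vec (kron_vec (vert_unit G u - vert_unit G v) (edge_dir p u v))"
    then have i: "i < card (verts G) * d" using dd by (simp add: kron_vec_def vert_unit_def)
    then have "i div d < card (verts G)" "i mod d < d"
      by (auto simp: less_mult_imp_div_less intro!: mod_less_divisor gr0I)
    moreover have "p u \<in> carrier_vec d" "p v \<in> carrier_vec d"
      using simple_graphD(3)[OF G e] p by (auto simp: placements_def)
    ultimately show "kron_vec (vert_unit G v - vert_unit G u) (edge_dir p v u) $ i
        = kron_vec (vert_unit G u - vert_unit G v) (edge_dir p u v) $ i"
      using i dd edge_dir_swap[of p u d v "i mod d"]
      by (simp add: kron_vec_def vert_unit_def algebra_simps)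
  qed
  have sub: "?k ` set (edge_list G) \<subseteq> ?C" using edge_list_mem[OF G] by auto
  have "dim_vec (kron_vec (vert_unit G u - vert_unit G v) (edge_dir p u v)) = d * card (verts G)"
    if "{u, v} \<in> edges G" for u v
    using dim[OF that] by (simp add: kron_vec_def vert_unit_def)
  then have "?C \<subseteq> carrier_vec (d * card (verts G))"
    unfolding carrier_vec_def by blast
  then have "set (cols (rigidity_mat d G p)) = ?k ` set (edge_list G)"
    unfolding rigidity_mat_def using sub by (subst cols_mat_of_cols) auto
  moreover have "?C \<subseteq> ?k ` set (edge_list G)"
  proof
    fix b assume "b \<in> ?C"
    then obtain u v where uv: "{u, v} \<in> edges G" "b = ?k (u, v)" by auto
    have "{u, v} \<in> ends ` set (edge_list G)" using uv(1) edge_list(2)[OF G] by simp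
    then obtain x y where q: "(x, y) \<in> set (edge_list G)" "{u, v} = {x, y}" by auto
    then have "x = u \<and> y = v \<or> x = v \<and> y = u" by (auto simp: doubleton_eq_iff)
    then have "b = ?k (x, y)" using swap[OF uv(1)] uv(2) by auto
    then show "b \<in> ?k ` set (edge_list G)" using q(1) by (rule image_eqI)
  qed
  ultimately show ?thesis using sub by blast
qed

lemma simple_graph_del_edge: "simple_graph G \<Longrightarrow> simple_graph (del_edge G e)"
  by (auto simp: simple_graph_def del_edge_def)

text \<open>A maximal independent set of columns can be charged to at most \<open>rank\<close> many
  edges, so some edge is not charged; deleting it leaves that independent set, and hence the rank,
  intact.\<close>

lemma del_edge_redundant:
  assumes G: "simple_graph G" and p: "p \<in> placements d G"
    and less: "vec_space.rank (d * card (verts G)) (rigidity_mat d G p) < card (edges G)"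
  shows "\<exists>e\<in>edges G. vec_space.rank (d * card (verts G)) (rigidity_mat d (del_edge G e) p)
           = vec_space.rank (d * card (verts G)) (rigidity_mat d G p)"
proof -
  interpret vec_space "TYPE(real)" "d * card (verts G)" .
  let ?R = "rigidity_mat d G p"
  have R: "?R \<in> carrier_mat (d * card (verts G)) (card (edges G))" by (rule rigidity_mat_carrier[OF G])
  obtain U where U: "U \<subseteq> set (cols ?R)" "lin_indpt U" "card U = rank ?R"
    using lin_indpt_cols_card_rank[OF R] by blast
  have "\<exists>e. e \<in> edges G \<and> (\<exists>u v. e = {u, v} \<and> b = kron_vec (vert_unit G u - vert_unit G v) (edge_dir p u v))"
    if "b \<in> U" for b
  proof -
    have "b \<in> set (cols ?R)" using that U(1) by blast
    then show ?thesis unfolding cols_rigidity_mat[OF G p] by blast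
  qed
  then obtain h where h: "\<And>b. b \<in> U \<Longrightarrow> h b \<in> edges G"
    "\<And>b. b \<in> U \<Longrightarrow> \<exists>u v. h b = {u, v} \<and> b = kron_vec (vert_unit G u - vert_unit G v) (edge_dir p u v)"
    by metis
  have finU: "finite U" using U(1) by (rule finite_subset) simp
  have "card (h ` U) < card (edges G)" using card_image_le[OF finU, of h] U(3) less by simp
  then have "\<not> edges G \<subseteq> h ` U" using finU by (meson card_mono finite_imageI leD)
  then obtain e where e: "e \<in> edges G" "e \<notin> h ` U" by blast
  let ?G = "del_edge G e"
  have G': "simple_graph ?G" by (rule simple_graph_del_edge[OF G])
  \<comment> \<open>The vertex enumeration depends on the vertex set only, so the unit vectors of
    both graphs coincide.\<close>
  have V: "verts ?G = verts G" and vu: "vert_unit ?G = vert_unit G"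
    by (auto simp: del_edge_def vert_unit_def vert_list_def fun_eq_iff)
  have p': "p \<in> placements d ?G" using p by (simp add: placements_def V)
  have R': "rigidity_mat d ?G p \<in> carrier_mat (d * card (verts G)) (card (edges ?G))"
    using rigidity_mat_carrier[OF G', of d p] by (simp add: V)
  have C': "set (cols (rigidity_mat d ?G p))
    = {kron_vec (vert_unit G u - vert_unit G v) (edge_dir p u v) | u v. {u, v} \<in> edges G - {e}}"
    using cols_rigidity_mat[OF G' p'] by (simp add: vu) (simp add: del_edge_def)
  have "b \<in> set (cols (rigidity_mat d ?G p))" if "b \<in> U" for b
  proof -
    have "h b \<in> edges G - {e}" using h(1) that e by blast
    then show ?thesis using h(2)[OF that] unfolding C' by auto
  qed
  then have "rank ?R \<le> rank (rigidity_mat d ?G p)"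
    using rank_ge_card_indpt[OF R', of U] U by auto
  moreover have "rank (rigidity_mat d ?G p) \<le> rank ?R"
    by (rule rank_mono_cols[OF R' R]) (auto simp: C' cols_rigidity_mat[OF G p])
  ultimately show ?thesis using e(1) by auto
qed

text \<open>At a placement witnessing rigidity the columns must be independent: otherwise an edge
  could be deleted without loss of rank, and the same placement would show the smaller graph
  rigid.\<close>

lemma minimally_rigid_card_edges:
  assumes G: "simple_graph G" and min: "minimally_rigid d G"
  shows "card (edges G) + ((d + 1) choose 2) = d * card (verts G)"
proof -
  let ?rk = "\<lambda>A. vec_space.rank (d * card (verts G)) (A :: real mat)"
  obtain p where p: "p \<in> placements d G"
    and rk: "int (?rk (rigidity_mat d G p)) = int (d * card (verts G)) - int ((d + 1) choose 2)"
    using min by (auto simp: minimally_rigid_def rigid_def)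
  have "\<not> ?rk (rigidity_mat d G p) < card (edges G)"
  proof
    assume "?rk (rigidity_mat d G p) < card (edges G)"
    then obtain e where e: "e \<in> edges G" "?rk (rigidity_mat d (del_edge G e) p) = ?rk (rigidity_mat d G p)"
      using del_edge_redundant[OF G p] by blast
    have "verts (del_edge G e) = verts G" by (simp add: del_edge_def)
    then have "rigid d (del_edge G e)"
      unfolding rigid_def using p rk e(2) by (intro bexI[of _ p]) (simp_all add: placements_def)
    then show False using min e(1) by (auto simp: minimally_rigid_def)
  qed
  then have "?rk (rigidity_mat d G p) = card (edges G)"
    using vec_space.rank_le_nc[OF rigidity_mat_carrier[OF G, of d p]] by simp
  then have "int (card (edges G) + ((d + 1) choose 2)) = int (d * card (verts G))"
    using rk by (simp only: of_nat_add)
  then show ?thesis by (simp only: of_nat_eq_iff)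
qed

section \<open>Lower bound for \<open>S\<^sub>n\<^sub>,\<^sub>d\<close>\<close>

text \<open>At a vertex \<open>x\<close>, the coordinate belonging to another clique vertex
  \<open>y\<close> is affected by the edge \<open>xy\<close> alone, and its square is the squared
  weight over the squared length. A clique edge, of squared length 2, contributes half from each
  end; an edge leaving the clique, of length 1, contributes fully from its outer end.\<close>

lemma stress_S_graph:
  assumes G: "simple_graph G" and iso: "graph_iso G (S_graph n d)"
  shows "\<exists>p\<in>placements d G. \<forall>\<omega>. (\<Sum>e\<in>edges G. (\<omega> e)\<^sup>2) \<le> stress_form d G p \<omega>"
proof -
  obtain f where f: "bij_betw f (verts G) {1..n}"
    and E: "{{i, j} | i j. i \<in> {1..d} \<and> j \<in> {1..n} - {i}} = (\<lambda>e. f ` e) ` edges G"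
    using iso by (auto simp: graph_iso_def S_graph_def)
  have inj: "inj_on f (verts G)" and img: "f ` verts G = {1..n}"
    using f by (auto simp: bij_betw_def)
  have f_range: "f x \<in> {1..n}" if "x \<in> verts G" for x using that img by blast
  have adj: "{x, y} \<in> edges G" if xy: "x \<in> verts G" "y \<in> verts G" "x \<noteq> y" "f y \<le> d" for x y
  proof -
    have "f x \<noteq> f y" using inj xy by (auto dest: inj_onD)
    then have "{f y, f x} \<in> (\<lambda>e. f ` e) ` edges G"
      unfolding E[symmetric] using f_range[OF xy(1)] f_range[OF xy(2)] xy(4) by fastforce
    then obtain e where e: "e \<in> edges G" "f ` e = f ` {x, y}" by (auto simp: insert_commute)
    moreover have "e \<subseteq> verts G" using G e(1) by (auto simp: simple_graph_def)
    ultimately show ?thesis using inj_on_image_eq_iff[OF inj, of e "{x, y}"] xy by auto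
  qed
  have adjD: "f x \<le> d \<or> f y \<le> d" if "{x, y} \<in> edges G" for x y
  proof -
    have "f ` {x, y} \<in> (\<lambda>e. f ` e) ` edges G" using that by (rule imageI)
    then obtain i j where "{f x, f y} = {i, j}" "i \<in> {1..d}" unfolding E[symmetric] by auto
    then show ?thesis by (auto simp: doubleton_eq_iff)
  qed
  define K where "K = {x \<in> verts G. f x \<le> d}"
  \<comment> \<open>The labels \<open>f x\<close> start at 1 and the basis vectors at 0, hence the
    shift.\<close>
  define p where "p x = (if f x \<le> d then unit_vec d (f x - 1) else 0\<^sub>v d :: real vec)" for x
  have pc: "p x \<in> carrier_vec d" for x by (simp add: p_def)
  have p_idx: "p x $ c = (if f x = Suc c then 1 else 0)" if "x \<in> verts G" "c < d" for x c
    using that f_range[OF that(1)] by (auto simp: p_def)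
  have finV: "finite (verts G)" by (rule simple_graphD(1)[OF G])
  have KV: "K \<subseteq> verts G" by (auto simp: K_def)
  have finK: "finite K" using KV finV by (rule finite_subset)
  have nbrs_K: "nbrs G x = (K - {x}) \<union> (verts G - K)" if "x \<in> K" for x
    using that adj[of _ x] simple_graphD(3)[OF G, of x] by (auto simp: nbrs_def K_def insert_commute)
  have nbrs_J: "nbrs G x = K" if "x \<in> verts G - K" for x
    using that adj[of x] adjD[of x] simple_graphD(3)[OF G, of x] by (auto simp: nbrs_def K_def)
  have K_nbrs: "K - {x} \<subseteq> nbrs G x" if "x \<in> verts G" for x
    using that adj[of x] by (auto simp: nbrs_def K_def)
  have f_ne: "f x \<noteq> f y" if "x \<in> verts G" "y \<in> verts G" "x \<noteq> y" for x y
    using inj that by (auto dest: inj_onD)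
  have len: "(vec_len (p x - p y))\<^sup>2 = (if x \<in> K then 2 else 1)" if x: "x \<in> verts G" and y: "y \<in> K - {x}" for x y
  proof -
    have fy: "f y - 1 < d" "Suc (f y - 1) = f y" "y \<in> verts G" using y f_range[of y] by (auto simp: K_def)
    have fxy: "f x \<noteq> f y" using f_ne[OF x] y fy by auto
    have "(vec_len (p x - p y))\<^sup>2 = (\<Sum>c<d. ((p x - p y) $ c)\<^sup>2)" using pc by (intro vec_len_square) auto
    also have "\<dots> = (\<Sum>c<d. (if c = f y - 1 then 1 else 0) + (if c = f x - 1 then 1 else 0 :: real))"
      using x fy pc[of y] fxy f_range[OF x] by (intro sum.cong) (auto simp: p_idx)
    also have "\<dots> = (if x \<in> K then 2 else 1)"
      using x fy f_range[OF x] by (auto simp: sum.distrib K_def)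
    finally show ?thesis .
  qed
  have main: "(\<Sum>e\<in>edges G. (\<omega> e)\<^sup>2) \<le> stress_form d G p \<omega>" for \<omega>
  proof -
    define F where "F x c = (\<Sum>z\<in>nbrs G x. \<omega> {x, z} * edge_dir p x z $ c)" for x c
    define g where "g x y = (\<omega> {x, y})\<^sup>2" for x y
    have F: "(F x (f y - 1))\<^sup>2 = g x y / (if x \<in> K then 2 else 1)" if x: "x \<in> verts G" and y: "y \<in> K - {x}" for x y
    proof -
      have fy: "f y - 1 < d" "Suc (f y - 1) = f y" "y \<in> verts G" using y f_range[of y] by (auto simp: K_def)
      have fxy: "f x \<noteq> f y" using f_ne[OF x] y fy by auto
      have zero: "edge_dir p x z $ (f y - 1) = 0" if z: "z \<in> nbrs G x - {y}" for z
      proof -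
        have "z \<in> verts G" using z simple_graphD(4)[OF G] by blast
        moreover have "f z \<noteq> f y" using f_ne[OF calculation fy(3)] z by blast
        ultimately show ?thesis using x fy fxy pc by (simp add: edge_dir_index[of _ _ d] p_idx)
      qed
      have "F x (f y - 1) = (\<Sum>z\<in>{y}. \<omega> {x, z} * edge_dir p x z $ (f y - 1))"
        unfolding F_def using zero K_nbrs[OF x] y simple_graphD(5)[OF G] by (intro sum.mono_neutral_right) auto
      also have "\<dots> = - \<omega> {x, y} / vec_len (p x - p y)"
        using x fy fxy pc by (simp add: edge_dir_index[of _ _ d] p_idx)
      finally show ?thesis using len[OF x y] by (simp add: power_divide g_def)
    qed
    \<comment> \<open>Only the coordinates of clique vertices other than \<open>x\<close> are kept;
      the remaining squares are nonnegative and are dropped.\<close>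
    have ge: "(\<Sum>y\<in>K - {x}. g x y) / (if x \<in> K then 2 else 1) \<le> (\<Sum>c<d. (F x c)\<^sup>2)" if x: "x \<in> verts G" for x
    proof -
      have "inj_on (\<lambda>y. f y - 1) (K - {x})"
      proof (rule inj_onI)
        fix y z assume yz: "y \<in> K - {x}" "z \<in> K - {x}" "f y - 1 = f z - 1"
        then have "f y = f z" using f_range[of y] f_range[of z] by (auto simp: K_def)
        then show "y = z" using yz f_ne by (auto simp: K_def)
      qed
      then have "(\<Sum>c\<in>(\<lambda>y. f y - 1) ` (K - {x}). (F x c)\<^sup>2) = (\<Sum>y\<in>K - {x}. (F x (f y - 1))\<^sup>2)"
        by (simp add: sum.reindex)
      also have "\<dots> = (\<Sum>y\<in>K - {x}. g x y) / (if x \<in> K then 2 else 1)"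
        unfolding sum_divide_distrib using F[OF x] by (intro sum.cong) auto
      finally have "(\<Sum>y\<in>K - {x}. g x y) / (if x \<in> K then 2 else 1) = (\<Sum>c\<in>(\<lambda>y. f y - 1) ` (K - {x}). (F x c)\<^sup>2)"
        by (rule sym)
      also have "\<dots> \<le> (\<Sum>c<d. (F x c)\<^sup>2)"
      proof (rule sum_mono2)
        have "f y - 1 < d" if "y \<in> K" for y using that f_range[of y] by (auto simp: K_def)
        then show "(\<lambda>y. f y - 1) ` (K - {x}) \<subseteq> {..<d}" by blast
      qed auto
      finally show ?thesis .
    qed
    \<comment> \<open>\<open>SJ\<close> meets each edge leaving the clique once and
      \<open>SK\<close> meets each clique edge twice, so the squared weights sum to
      \<open>SK / 2 + SJ\<close>.\<close>
    define SJ where "SJ = (\<Sum>x\<in>verts G - K. \<Sum>y\<in>K. g x y)"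
    define SK where "SK = (\<Sum>x\<in>K. \<Sum>y\<in>K - {x}. g x y)"
    have swap: "(\<Sum>x\<in>K. \<Sum>y\<in>verts G - K. g x y) = SJ"
      unfolding SJ_def g_def by (subst sum.swap) (simp add: insert_commute)
    have split: "sum h (verts G) = sum h K + sum h (verts G - K)" for h :: "'a \<Rightarrow> real"
      using sum.subset_diff[OF KV finV, of h] by simp
    have "2 * (\<Sum>e\<in>edges G. (\<omega> e)\<^sup>2) = (\<Sum>x\<in>verts G. \<Sum>y\<in>nbrs G x. g x y)"
      using sum_nbrs_handshake[OF G, of "\<lambda>e. (\<omega> e)\<^sup>2"] by (simp add: g_def)
    also have "\<dots> = (\<Sum>x\<in>K. (\<Sum>y\<in>K - {x}. g x y) + (\<Sum>y\<in>verts G - K. g x y)) + SJ"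
      unfolding split SJ_def
      using finK finV by (intro arg_cong2[where f = "(+)"] sum.cong) (auto simp: nbrs_K nbrs_J intro!: sum.union_disjoint)
    also have "\<dots> = SK + 2 * SJ" by (simp add: sum.distrib swap SK_def)
    finally have "(\<Sum>e\<in>edges G. (\<omega> e)\<^sup>2) = SK / 2 + SJ" by simp
    also have "\<dots> = (\<Sum>x\<in>verts G. (\<Sum>y\<in>K - {x}. g x y) / (if x \<in> K then 2 else 1))"
      unfolding split SK_def SJ_def sum_divide_distrib
      by (intro arg_cong2[where f = "(+)"] sum.cong) (auto intro!: sum.cong)
    also have "\<dots> \<le> stress_form d G p \<omega>"
      unfolding stress_form_def F_def[symmetric] by (intro sum_mono ge)
    finally show ?thesis .
  qed
  have "p \<in> placements d G" using pc by (simp add: placements_def)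
  then show ?thesis using main by blast
qed

section \<open>Graphs of low degree are complete\<close>

definition is_complete :: "'a graph \<Rightarrow> bool" where
  "is_complete G \<longleftrightarrow> (\<forall>x\<in>verts G. \<forall>y\<in>verts G. x \<noteq> y \<longrightarrow> {x, y} \<in> edges G)"

lemma complete_imp_iso_complete_graph:
  assumes G: "simple_graph G" and complete: "is_complete G"
  shows "graph_iso G (complete_graph (card (verts G)))"
proof -
  let ?n = "card (verts G)"
  obtain f where f: "bij_betw f (verts G) {1..?n}"
    using finite_same_card_bij[of "verts G" "{1..?n}"] simple_graphD(1)[OF G] by auto
  have inj: "inj_on f (verts G)" and img: "f ` verts G = {1..?n}"
    using f by (auto simp: bij_betw_def)
  have "{{i, j} | i j. i \<in> {1..?n} \<and> j \<in> {1..?n} - {i}} = (\<lambda>e. f ` e) ` edges G" (is "?L = ?R")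
  proof
    show "?L \<subseteq> ?R"
    proof
      fix s assume "s \<in> ?L"
      then obtain i j where ij: "s = {i, j}" "i \<in> {1..?n}" "j \<in> {1..?n}" "j \<noteq> i"
        unfolding mem_Collect_eq by (elim exE conjE DiffE) simp
      obtain x y where xy: "x \<in> verts G" "y \<in> verts G" "i = f x" "j = f y"
        using ij(2,3) img by (metis imageE)
      have "x \<noteq> y" using ij(4) xy(3,4) by auto
      then have "{x, y} \<in> edges G" using complete xy(1,2) by (simp add: is_complete_def)
      then show "s \<in> ?R" using xy ij(1) by (intro image_eqI[of _ _ "{x, y}"]) auto
    qed
    show "?R \<subseteq> ?L"
    proof
      fix s assume "s \<in> ?R"
      then obtain e where e: "e \<in> edges G" "s = f ` e" by blast
      then obtain x y where xy: "e = {x, y}" using G by (auto simp: simple_graph_def card_2_iff)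
      then have V: "x \<in> verts G" "y \<in> verts G" "x \<noteq> y" using simple_graphD(3)[OF G, of x y] e by auto
      have ran: "f x \<in> {1..?n}" "f y \<in> {1..?n}" using V img by (metis imageI)+
      have "f y \<noteq> f x" using V inj by (metis inj_onD)
      moreover have "s = {f x, f y}" using e xy by simp
      ultimately show "s \<in> ?L" unfolding mem_Collect_eq using ran by (intro exI conjI) auto
    qed
  qed
  then show ?thesis using f by (auto simp: graph_iso_def complete_graph_def)
qed

lemma card_edges_max_imp_complete:
  assumes G: "simple_graph G" and card: "card (edges G) = card (verts G) choose 2"
  shows "is_complete G"
proof -
  let ?P = "{e. e \<subseteq> verts G \<and> card e = 2}"
  have "finite ?P" "edges G \<subseteq> ?P" using G by (auto simp: simple_graph_def)
  moreover have "card ?P = card (edges G)" using n_subsets[OF simple_graphD(1)[OF G], of 2] card by simp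
  ultimately have "edges G = ?P" by (metis card_subset_eq)
  then show ?thesis by (auto simp: is_complete_def)
qed

text \<open>The handshake gives \<open>2 |E| \<le> d n\<close>, and the edge count turns this into
  \<open>n \<le> d + 1\<close>. For both remaining values, \<open>n = d\<close> and
  \<open>n = d + 1\<close>, the edge count equals \<open>n choose 2\<close>.\<close>

lemma low_degree_imp_complete:
  assumes G: "simple_graph G" and d: "d \<ge> 1" "d \<le> card (verts G)"
    and count: "card (edges G) + ((d + 1) choose 2) = d * card (verts G)"
    and deg: "\<And>x. card (nbrs G x) \<le> d"
  shows "is_complete G"
proof -
  let ?n = "card (verts G)" and ?m = "card (edges G)"
  have "2 * ?m = (\<Sum>x\<in>verts G. card (nbrs G x))"
    using sum_nbrs_handshake[OF G, of "\<lambda>_. 1 :: nat"] by simp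
  also have "\<dots> \<le> d * ?n" using sum_mono[of "verts G" "\<lambda>x. card (nbrs G x)" "\<lambda>_. d"] deg by (simp add: mult.commute)
  finally have le: "2 * ?m \<le> d * ?n" .
  have "2 * ((d + 1) choose 2) = d * (d + 1)" by (simp add: choose_two)
  then have m2: "2 * ?m + d * (d + 1) = 2 * (d * ?n)" using count by linarith
  then have "d * ?n \<le> d * (d + 1)" using le by linarith
  then have "?n \<le> d + 1" using d by (simp only: mult_le_cancel1)
  then consider "?n = d" | "?n = d + 1" using d by linarith
  then have "2 * ?m = ?n * (?n - 1)"
  proof cases
    case 1
    then have "2 * ?m + d * (d + 1) = 2 * (d * d)" using m2 by simp
    then show ?thesis using 1 d by (cases d) (auto simp: algebra_simps)
  next
    case 2
    then show ?thesis using m2 by (simp add: algebra_simps)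
  qed
  then have "?m = ?n choose 2" by (simp add: choose_two)
  then show ?thesis by (rule card_edges_max_imp_complete[OF G])
qed

section \<open>Test weights for every placement and the two bounds on
  \<open>alg_connectivity\<close>\<close>

lemma exists_stress:
  assumes G: "simple_graph G" and p: "p \<in> placements d G"
    and d: "d \<ge> 1" "d \<le> card (verts G)"
    and count: "card (edges G) + ((d + 1) choose 2) = d * card (verts G)" "edges G \<noteq> {}"
    and not_K2: "\<not> graph_iso G (complete_graph 2)" and not_K3: "\<not> graph_iso G (complete_graph 3)"
  shows "\<exists>\<omega>. (\<exists>e\<in>edges G. \<omega> e \<noteq> 0) \<and> stress_form d G p \<omega> \<le> (\<Sum>e\<in>edges G. (\<omega> e)\<^sup>2)"
proof (cases "\<exists>x. d < card (nbrs G x)")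
  case True
  then show ?thesis using stress_star[OF G p] by blast
next
  case False
  then have "is_complete G" using low_degree_imp_complete[OF G d count(1)] by (simp add: not_less)
  then have "graph_iso G (complete_graph (card (verts G)))"
    using complete_imp_iso_complete_graph[OF G] by blast
  \<comment> \<open>The excluded K2 and K3 rule out two and three vertices, and an edge rules out
    fewer than two; a complete graph on the remaining sizes contains a K4.\<close>
  then have "card (verts G) \<noteq> 2" "card (verts G) \<noteq> 3" using not_K2 not_K3 by metis+
  moreover have "card (verts G) \<ge> 2"
  proof -
    obtain e where "e \<in> edges G" using count by blast
    then have "e \<subseteq> verts G" "card e = 2" using G by (auto simp: simple_graph_def)
    then show ?thesis using card_mono[OF simple_graphD(1)[OF G]] by metis
  qed
  ultimately have "4 \<le> card (verts G)" by linarith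
  then obtain S where S: "S \<subseteq> verts G" "card S = 4" "finite S"
    using obtain_subset_with_card_n by metis
  then obtain xs where "distinct xs" "set xs = S" "length xs = 4"
    using finite_distinct_list distinct_card by metis
  then obtain a b u v where abuv: "distinct [a, b, u, v]" "{a, b, u, v} = S"
    by (auto simp: numeral_eq_Suc length_Suc_conv)
  show ?thesis
  proof (rule stress_K4[OF G p abuv(1)])
    show "{x, y} \<in> edges G" if "x \<in> {a, b, u, v}" "y \<in> {a, b, u, v}" "x \<noteq> y" for x y
      using that abuv(2) S(1) \<open>is_complete G\<close> unfolding is_complete_def by blast
  qed
qed

theorem theorem1p7:
  fixes T :: "'a graph" and d :: nat
  assumes "d \<ge> 1"
    and "simple_graph T"
    and "d \<le> card (verts T)"
    and "((d + 1) choose 2) + 1 \<le> d * card (verts T)"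
    and "minimally_rigid d T"
    and "\<not> graph_iso T (complete_graph 2)"
    and "\<not> graph_iso T (complete_graph 3)"
  shows "alg_connectivity d T \<le> 1 \<and>
         ((\<exists>n\<ge>d + 1. graph_iso T (S_graph n d)) \<longrightarrow> alg_connectivity d T = 1)"
proof -
  let ?\<nu> = "\<lambda>p. nth_eigenvalue (((d + 1) choose 2) + 1) (stiffness_mat d T p)"
  have count: "card (edges T) + ((d + 1) choose 2) = d * card (verts T)"
    by (rule minimally_rigid_card_edges[OF assms(2,5)])
  \<comment> \<open>The eigenvalue index lies within the matrix size
    \<open>d * card (verts T)\<close>, which by the edge count means that there is an edge.\<close>
  then have ne: "edges T \<noteq> {}" using assms(4) by auto
  \<comment> \<open>The number of zeros split off from the spectrum, \<open>d |V| - |E|\<close>, is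
    exactly \<open>(d + 1) choose 2\<close>, so the Gram matrix results speak about the eigenvalue
    in \<open>alg_connectivity\<close>.\<close>
  have le: "card (edges T) \<le> d * card (verts T)"
    and idx: "d * card (verts T) - card (edges T) + 1 = ((d + 1) choose 2) + 1"
    using count by linarith+
  have upper: "?\<nu> p \<le> 1" if p: "p \<in> placements d T" for p
    using exists_stress[OF assms(2) p assms(1,3) count ne assms(6,7)]
      nth_eigenvalue_stiffness_le_1[OF assms(2) p le] unfolding idx by blast
  \<comment> \<open>Bounding a supremum from above in the reals needs a nonempty index set; all
    vertices at the origin give a placement.\<close>
  have "(\<lambda>_. 0\<^sub>v d) \<in> placements d T" by (simp add: placements_def)
  then have sup: "alg_connectivity d T \<le> 1"
    unfolding alg_connectivity_def using upper by (intro cSUP_least) auto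
  have "alg_connectivity d T = 1" if iso: "graph_iso T (S_graph n d)" for n
  proof -
    obtain p where p: "p \<in> placements d T" "\<And>\<omega>. (\<Sum>e\<in>edges T. (\<omega> e)\<^sup>2) \<le> stress_form d T p \<omega>"
      using stress_S_graph[OF assms(2) iso] by auto
    have "1 \<le> ?\<nu> p"
      using nth_eigenvalue_stiffness_ge_1[OF assms(2) p(1) le ne p(2)] unfolding idx .
    \<comment> \<open>The upper bound reappears here as the boundedness that lets the supremum
      dominate the value at \<open>p\<close>.\<close>
    also have "\<dots> \<le> alg_connectivity d T"
      unfolding alg_connectivity_def using upper by (intro cSUP_upper p(1) bdd_aboveI2)
    finally show ?thesis using sup by simp
  qed
  then show ?thesis using sup by blast
qed

end
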